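(* Let $X$ be a compact Hausdorff space and $\mathcal C$ a $C(X)$-category. Then there exists a family $\{x_*:\mathcal C\to\mathcal C_x\}_{x\in X}$ of $C^*$-functors, where $\mathcal C_x$ is the fiber category with arrow spaces $(\rho,\sigma)_x$, such that for every arrow $t\in(\rho,\sigma)$ of $\mathcal C$, setting $t_x:=x_*(t)$: (1) the norm function $n(t):x\mapsto\|t_x\|$ is upper semicontinuous on $X$; (2) $\|t\|=\sup_{x\in X}\|t_x\|$.
   Context: A $C^*$-category is a category whose arrow spaces $(\rho,\sigma)$ (arrows from $\rho$ to $\sigma$) are complex Banach spaces, with bilinear norm-decreasing composition and an isometric antilinear involutive cofunctor $*$, trivial on objects, satisfying the $C^*$-identity $\|t^*\circ t\|=\|t\|^2$; each $(\rho,\rho)$ is a unital $C^*$-algebra. $C^*$-functors are functors preserving this structure. Each $(\rho,\sigma)$ is, by composition, a Hilbert bimodule with left action of $(\sigma,\sigma)$ and right action of $(\rho,\rho)$; the $(\rho,\rho)$-valued scalar product is $\langle t,t'\rangle=t^*\circ t'$. Multipliers. A right (resp. left) multiplier of $\mathcal C$ is a uniformly bounded family $F=\{F_{\rho,\sigma}:(\rho,\sigma)\to(\rho,\sigma)\}$ of Banach space maps such that $F_{\rho,\tau}(t\circ t')=t\circ F_{\rho,\sigma}(t')$ (resp. $F_{\rho,\tau}(t\circ t')=F_{\sigma,\tau}(t)\circ t'$) for $t'\in(\rho,\sigma)$, $t\in(\sigma,\tau)$. A multiplier is a pair $F=(F^l,F^r)$ with $F^l$ a left and $F^r$ a right multiplier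 satisfying $t\circ F^l_{\rho,\sigma}(t')=F^r_{\sigma,\tau}(t)\circ t'$ for all such $t,t'$. Multipliers form a unital $C^*$-algebra $M(\mathcal C)$ with product $F\cdot G=(F^l\circ G^l,G^r\circ F^r)$, supremum norm, and involution sending $F$ to the multiplier whose left component is $t\mapsto(F^r_{\sigma,\rho}(t^* ))^*$ and whose right component is $t\mapsto(F^l_{\sigma,\rho}(t^* ))^*$ for $t\in(\rho,\sigma)$. $Z(\mathcal C)\subseteq M(\mathcal C)$ is the abelian $C^*$-subalgebra of multipliers $Z$ with $Z^l=Z^r$. For $X$ compact Hausdorff, a $C(X)$-category is a $C^*$-category $\mathcal C$ with a unital homomorphism $C(X)\to Z(\mathcal C)$. Then each $(\rho,\rho)$ is a $C(X)$-algebra and each $(\rho,\sigma)$ a $C(X)$-module. Fibers. For $x\in X$ let $(\rho,\rho)_x$ be the quotient of $(\rho,\rho)$ by the ideal $(\rho,\rho)\cdot\{f\in C(X):f(x)=0\}$, and $(\rho,\sigma)_x:=(\rho,\sigma)\otimes_{(\rho,\rho)}(\rho,\rho)_x$ (tensor product of Hilbert modules). $\mathcal C_x$ is the category with objects $\rho_x:=\{\rho,x\}$, $\rho$ an object of $\mathcal C$, arrow spaces $(\rho_x,\sigma_x):=(\rho,\sigma)_x$, and composition and involution induced from $\mathcal C$ by the canonical projections $(\rho,\sigma)\to(\rho,\sigma)_x$, which define $x_*$. *)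

theory Defs
  imports "HOL-Analysis.Analysis"
begin

section \<open>Complex Banach spaces with explicit carrier\<close>

record 'v cspace =
  vecs :: "'v set"
  vzero :: 'v
  vadd :: "'v \<Rightarrow> 'v \<Rightarrow> 'v"
  vscale :: "complex \<Rightarrow> 'v \<Rightarrow> 'v"
  vnorm :: "'v \<Rightarrow> real"

definition vdiff :: "'v cspace \<Rightarrow> 'v \<Rightarrow> 'v \<Rightarrow> 'v" where
  "vdiff V u v = vadd V u (vscale V (- 1) v)"

text \<open>The distance is set to 0 off the carrier because the library's metrics are required to be
  nonnegative and symmetric on the whole type.\<close>

definition vmetric :: "'v cspace \<Rightarrow> 'v metric" where
  "vmetric V = metric (vecs V,
     \<lambda>u v. if u \<in> vecs V \<and> v \<in> vecs V then vnorm V (vdiff V u v) else 0)"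

locale complex_banach =
  fixes V :: "'v cspace"
  assumes zero_closed: "vzero V \<in> vecs V"
    and add_closed: "\<lbrakk>u \<in> vecs V; v \<in> vecs V\<rbrakk> \<Longrightarrow> vadd V u v \<in> vecs V"
    and scale_closed: "v \<in> vecs V \<Longrightarrow> vscale V c v \<in> vecs V"
    and add_assoc: "\<lbrakk>u \<in> vecs V; v \<in> vecs V; w \<in> vecs V\<rbrakk>
      \<Longrightarrow> vadd V (vadd V u v) w = vadd V u (vadd V v w)"
    and add_commute: "\<lbrakk>u \<in> vecs V; v \<in> vecs V\<rbrakk> \<Longrightarrow> vadd V u v = vadd V v u"
    and add_zero: "v \<in> vecs V \<Longrightarrow> vadd V (vzero V) v = v"
    and diff_self: "v \<in> vecs V \<Longrightarrow> vdiff V v v = vzero V"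
    and scale_add: "\<lbrakk>u \<in> vecs V; v \<in> vecs V\<rbrakk>
      \<Longrightarrow> vscale V c (vadd V u v) = vadd V (vscale V c u) (vscale V c v)"
    and add_scale: "v \<in> vecs V \<Longrightarrow> vscale V (c + d) v = vadd V (vscale V c v) (vscale V d v)"
    and scale_scale: "v \<in> vecs V \<Longrightarrow> vscale V c (vscale V d v) = vscale V (c * d) v"
    and scale_one: "v \<in> vecs V \<Longrightarrow> vscale V 1 v = v"
    and norm_nonneg: "v \<in> vecs V \<Longrightarrow> 0 \<le> vnorm V v"
    and norm_eq_zero: "v \<in> vecs V \<Longrightarrow> vnorm V v = 0 \<longleftrightarrow> v = vzero V"
    and norm_add: "\<lbrakk>u \<in> vecs V; v \<in> vecs V\<rbrakk> \<Longrightarrow> vnorm V (vadd V u v) \<le> vnorm V u + vnorm V v"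
    and norm_scale: "v \<in> vecs V \<Longrightarrow> vnorm V (vscale V c v) = cmod c * vnorm V v"
    and complete: "mcomplete_of (vmetric V)"

definition linear_map :: "'v cspace \<Rightarrow> 'w cspace \<Rightarrow> ('v \<Rightarrow> 'w) \<Rightarrow> bool" where
  "linear_map V W f \<longleftrightarrow>
     f ` vecs V \<subseteq> vecs W \<and>
     (\<forall>u\<in>vecs V. \<forall>v\<in>vecs V. f (vadd V u v) = vadd W (f u) (f v)) \<and>
     (\<forall>c. \<forall>v\<in>vecs V. f (vscale V c v) = vscale W c (f v))"

definition antilinear_map :: "'v cspace \<Rightarrow> 'w cspace \<Rightarrow> ('v \<Rightarrow> 'w) \<Rightarrow> bool" where
  "antilinear_map V W f \<longleftrightarrow>
     f ` vecs V \<subseteq> vecs W \<and>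
     (\<forall>u\<in>vecs V. \<forall>v\<in>vecs V. f (vadd V u v) = vadd W (f u) (f v)) \<and>
     (\<forall>c. \<forall>v\<in>vecs V. f (vscale V c v) = vscale W (cnj c) (f v))"

definition closed_subspace :: "'v cspace \<Rightarrow> 'v set \<Rightarrow> bool" where
  "closed_subspace V W \<longleftrightarrow>
     vzero V \<in> W \<and> (\<forall>u\<in>W. \<forall>v\<in>W. vadd V u v \<in> W) \<and> (\<forall>c. \<forall>v\<in>W. vscale V c v \<in> W) \<and>
     closedin (mtopology_of (vmetric V)) W"

definition closed_span :: "'v cspace \<Rightarrow> 'v set \<Rightarrow> 'v set" where
  "closed_span V S = closed_subspace V hull S"

definition rep :: "'v set \<Rightarrow> 'v" where
  "rep A = (SOME a. a \<in> A)"

definition quot_class :: "'v cspace \<Rightarrow> 'v set \<Rightarrow> 'v \<Rightarrow> 'v set" where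
  "quot_class V I v = {w \<in> vecs V. vdiff V w v \<in> I}"

definition quot_space :: "'v cspace \<Rightarrow> 'v set \<Rightarrow> 'v set cspace" where
  "quot_space V I =
    \<lparr>vecs = quot_class V I ` vecs V,
     vzero = quot_class V I (vzero V),
     vadd = (\<lambda>A B. quot_class V I (vadd V (rep A) (rep B))),
     vscale = (\<lambda>c A. quot_class V I (vscale V c (rep A))),
     vnorm = (\<lambda>A. Inf (vnorm V ` A))\<rparr>"

text \<open>Hausdorff completion of a seminormed space: Cauchy sequences modulo null sequences.  Only the
  seminorm of \<open>V\<close> matters here, so \<open>V\<close> may satisfy the vector space laws merely up to vectors of
  seminorm 0.\<close>

definition cauchy_seq :: "'v cspace \<Rightarrow> (nat \<Rightarrow> 'v) \<Rightarrow> bool" where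
  "cauchy_seq V s \<longleftrightarrow> range s \<subseteq> vecs V \<and>
     (\<forall>e>0. \<exists>N. \<forall>m\<ge>N. \<forall>n\<ge>N. vnorm V (vdiff V (s m) (s n)) < e)"

definition compl_class :: "'v cspace \<Rightarrow> (nat \<Rightarrow> 'v) \<Rightarrow> (nat \<Rightarrow> 'v) set" where
  "compl_class V s =
     {s'. cauchy_seq V s' \<and> (\<lambda>n. vnorm V (vdiff V (s' n) (s n))) \<longlonglongrightarrow> 0}"

definition completion :: "'v cspace \<Rightarrow> (nat \<Rightarrow> 'v) set cspace" where
  "completion V =
    \<lparr>vecs = compl_class V ` {s. cauchy_seq V s},
     vzero = compl_class V (\<lambda>n. vzero V),
     vadd = (\<lambda>A B. compl_class V (\<lambda>n. vadd V (rep A n) (rep B n))),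
     vscale = (\<lambda>c A. compl_class V (\<lambda>n. vscale V c (rep A n))),
     vnorm = (\<lambda>A. lim (\<lambda>n. vnorm V (rep A n)))\<rparr>"


section \<open>Interior tensor product of Hilbert modules\<close>

text \<open>\<open>E\<close> is a right Hilbert module with scalar product \<open>ipE\<close>, and \<open>F\<close> is a right Hilbert
  \<open>B\<close>-module with scalar product \<open>ipF\<close> on which the coefficient algebra of \<open>E\<close> acts from the left
  by \<open>act\<close>.  The list \<open>[(e1,f1),\<dots>,(ek,fk)]\<close> stands for the formal sum of the elementary tensors of
  \<open>ei\<close> and \<open>fi\<close>.  The scalar product is determined by
  \<open>\<langle>e \<otimes> f, e' \<otimes> f'\<rangle> = \<langle>f, \<langle>e,e'\<rangle> f'\<rangle>\<close>, and bilinearity and balancing hold after the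
  separation built into \<^const>\<open>completion\<close>.\<close>

definition tensor_ip :: "('e \<Rightarrow> 'e \<Rightarrow> 'a) \<Rightarrow> ('a \<Rightarrow> 'f \<Rightarrow> 'f) \<Rightarrow> ('f \<Rightarrow> 'f \<Rightarrow> 'b) \<Rightarrow> 'b cspace \<Rightarrow>
    ('e \<times> 'f) list \<Rightarrow> ('e \<times> 'f) list \<Rightarrow> 'b" where
  "tensor_ip ipE act ipF B z z' =
     foldr (vadd B) [ipF f (act (ipE e e') f'). (e, f) \<leftarrow> z, (e', f') \<leftarrow> z'] (vzero B)"

definition pre_tensor :: "'e cspace \<Rightarrow> ('e \<Rightarrow> 'e \<Rightarrow> 'a) \<Rightarrow> 'f cspace \<Rightarrow> ('a \<Rightarrow> 'f \<Rightarrow> 'f) \<Rightarrow>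
    ('f \<Rightarrow> 'f \<Rightarrow> 'b) \<Rightarrow> 'b cspace \<Rightarrow> ('e \<times> 'f) list cspace" where
  "pre_tensor E ipE F act ipF B =
    \<lparr>vecs = lists (vecs E \<times> vecs F),
     vzero = [],
     vadd = (@),
     vscale = (\<lambda>c. map (\<lambda>(e, f). (vscale E c e, f))),
     vnorm = (\<lambda>z. sqrt (vnorm B (tensor_ip ipE act ipF B z z)))\<rparr>"


section \<open>C*-categories\<close>

text \<open>\<open>arrs C \<rho> \<sigma>\<close> is the space of arrows from \<open>\<rho>\<close> to \<open>\<sigma>\<close>; distinct arrow spaces need not be
  disjoint, so all operations carry their objects.  \<open>comp C \<rho> \<sigma> \<tau> t t'\<close> is the composite of
  \<open>t' : \<rho> \<rightarrow> \<sigma>\<close> followed by \<open>t : \<sigma> \<rightarrow> \<tau>\<close>, and \<open>star C \<rho> \<sigma>\<close> maps arrows \<open>\<rho> \<rightarrow> \<sigma>\<close> to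
  arrows \<open>\<sigma> \<rightarrow> \<rho>\<close>.\<close>

record ('o, 'a) ccat =
  objs :: "'o set"
  arrs :: "'o \<Rightarrow> 'o \<Rightarrow> 'a cspace"
  comp :: "'o \<Rightarrow> 'o \<Rightarrow> 'o \<Rightarrow> 'a \<Rightarrow> 'a \<Rightarrow> 'a"
  ident :: "'o \<Rightarrow> 'a"
  star :: "'o \<Rightarrow> 'o \<Rightarrow> 'a \<Rightarrow> 'a"

abbreviation hom :: "('o, 'a) ccat \<Rightarrow> 'o \<Rightarrow> 'o \<Rightarrow> 'a set" where
  "hom C \<rho> \<sigma> \<equiv> vecs (arrs C \<rho> \<sigma>)"

locale cstar_category =
  fixes C :: "('o, 'a) ccat"
  assumes banach: "\<lbrakk>\<rho> \<in> objs C; \<sigma> \<in> objs C\<rbrakk> \<Longrightarrow> complex_banach (arrs C \<rho> \<sigma>)"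
    and ident_hom: "\<rho> \<in> objs C \<Longrightarrow> ident C \<rho> \<in> hom C \<rho> \<rho>"
    and comp_ident: "\<lbrakk>\<rho> \<in> objs C; \<sigma> \<in> objs C; t \<in> hom C \<rho> \<sigma>\<rbrakk> \<Longrightarrow> comp C \<rho> \<rho> \<sigma> t (ident C \<rho>) = t"
    and ident_comp: "\<lbrakk>\<rho> \<in> objs C; \<sigma> \<in> objs C; t \<in> hom C \<rho> \<sigma>\<rbrakk> \<Longrightarrow> comp C \<rho> \<sigma> \<sigma> (ident C \<sigma>) t = t"
    and comp_assoc: "\<lbrakk>\<rho> \<in> objs C; \<sigma> \<in> objs C; \<tau> \<in> objs C; \<upsilon> \<in> objs C;
        r \<in> hom C \<rho> \<sigma>; s \<in> hom C \<sigma> \<tau>; t \<in> hom C \<tau> \<upsilon>\<rbrakk>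
      \<Longrightarrow> comp C \<rho> \<sigma> \<upsilon> (comp C \<sigma> \<tau> \<upsilon> t s) r = comp C \<rho> \<tau> \<upsilon> t (comp C \<rho> \<sigma> \<tau> s r)"
    and comp_linear_right: "\<lbrakk>\<rho> \<in> objs C; \<sigma> \<in> objs C; \<tau> \<in> objs C; t \<in> hom C \<sigma> \<tau>\<rbrakk>
      \<Longrightarrow> linear_map (arrs C \<rho> \<sigma>) (arrs C \<rho> \<tau>) (\<lambda>t'. comp C \<rho> \<sigma> \<tau> t t')"
    and comp_linear_left: "\<lbrakk>\<rho> \<in> objs C; \<sigma> \<in> objs C; \<tau> \<in> objs C; t' \<in> hom C \<rho> \<sigma>\<rbrakk>
      \<Longrightarrow> linear_map (arrs C \<sigma> \<tau>) (arrs C \<rho> \<tau>) (\<lambda>t. comp C \<rho> \<sigma> \<tau> t t')"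
    and norm_comp: "\<lbrakk>\<rho> \<in> objs C; \<sigma> \<in> objs C; \<tau> \<in> objs C; t' \<in> hom C \<rho> \<sigma>; t \<in> hom C \<sigma> \<tau>\<rbrakk>
      \<Longrightarrow> vnorm (arrs C \<rho> \<tau>) (comp C \<rho> \<sigma> \<tau> t t')
          \<le> vnorm (arrs C \<sigma> \<tau>) t * vnorm (arrs C \<rho> \<sigma>) t'"
    and star_antilinear: "\<lbrakk>\<rho> \<in> objs C; \<sigma> \<in> objs C\<rbrakk>
      \<Longrightarrow> antilinear_map (arrs C \<rho> \<sigma>) (arrs C \<sigma> \<rho>) (star C \<rho> \<sigma>)"
    and norm_star: "\<lbrakk>\<rho> \<in> objs C; \<sigma> \<in> objs C; t \<in> hom C \<rho> \<sigma>\<rbrakk>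
      \<Longrightarrow> vnorm (arrs C \<sigma> \<rho>) (star C \<rho> \<sigma> t) = vnorm (arrs C \<rho> \<sigma>) t"
    and star_star: "\<lbrakk>\<rho> \<in> objs C; \<sigma> \<in> objs C; t \<in> hom C \<rho> \<sigma>\<rbrakk> \<Longrightarrow> star C \<sigma> \<rho> (star C \<rho> \<sigma> t) = t"
    and star_ident: "\<rho> \<in> objs C \<Longrightarrow> star C \<rho> \<rho> (ident C \<rho>) = ident C \<rho>"
    and star_comp: "\<lbrakk>\<rho> \<in> objs C; \<sigma> \<in> objs C; \<tau> \<in> objs C; t' \<in> hom C \<rho> \<sigma>; t \<in> hom C \<sigma> \<tau>\<rbrakk>
      \<Longrightarrow> star C \<rho> \<tau> (comp C \<rho> \<sigma> \<tau> t t') = comp C \<tau> \<sigma> \<rho> (star C \<rho> \<sigma> t') (star C \<sigma> \<tau> t)"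
    and cstar_identity: "\<lbrakk>\<rho> \<in> objs C; \<sigma> \<in> objs C; t \<in> hom C \<rho> \<sigma>\<rbrakk>
      \<Longrightarrow> vnorm (arrs C \<rho> \<rho>) (comp C \<rho> \<sigma> \<rho> (star C \<rho> \<sigma> t) t) = (vnorm (arrs C \<rho> \<sigma>) t)\<^sup>2"

record ('o, 'a, 'p, 'b) cfunctor =
  fobj :: "'o \<Rightarrow> 'p"
  farr :: "'o \<Rightarrow> 'o \<Rightarrow> 'a \<Rightarrow> 'b"

locale cstar_functor =
  fixes C :: "('o, 'a) ccat" and D :: "('p, 'b) ccat" and F :: "('o, 'a, 'p, 'b) cfunctor"
  assumes source: "cstar_category C"
    and target: "cstar_category D"
    and fobj_objs: "\<rho> \<in> objs C \<Longrightarrow> fobj F \<rho> \<in> objs D"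
    and farr_linear: "\<lbrakk>\<rho> \<in> objs C; \<sigma> \<in> objs C\<rbrakk>
      \<Longrightarrow> linear_map (arrs C \<rho> \<sigma>) (arrs D (fobj F \<rho>) (fobj F \<sigma>)) (farr F \<rho> \<sigma>)"
    and farr_ident: "\<rho> \<in> objs C \<Longrightarrow> farr F \<rho> \<rho> (ident C \<rho>) = ident D (fobj F \<rho>)"
    and farr_comp: "\<lbrakk>\<rho> \<in> objs C; \<sigma> \<in> objs C; \<tau> \<in> objs C; t' \<in> hom C \<rho> \<sigma>; t \<in> hom C \<sigma> \<tau>\<rbrakk>
      \<Longrightarrow> farr F \<rho> \<tau> (comp C \<rho> \<sigma> \<tau> t t') =
          comp D (fobj F \<rho>) (fobj F \<sigma>) (fobj F \<tau>) (farr F \<sigma> \<tau> t) (farr F \<rho> \<sigma> t')"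
    and farr_star: "\<lbrakk>\<rho> \<in> objs C; \<sigma> \<in> objs C; t \<in> hom C \<rho> \<sigma>\<rbrakk>
      \<Longrightarrow> farr F \<sigma> \<rho> (star C \<rho> \<sigma> t) = star D (fobj F \<rho>) (fobj F \<sigma>) (farr F \<rho> \<sigma> t)"


section \<open>Multipliers\<close>

type_synonym ('o, 'a) family = "'o \<Rightarrow> 'o \<Rightarrow> 'a \<Rightarrow> 'a"

text \<open>A multiplier is the pair of its left component (\<^const>\<open>fst\<close>) and its right component
  (\<^const>\<open>snd\<close>).  Only the values on arrow spaces are meaningful; accordingly \<open>mult_eq\<close> below is
  equality of multipliers.\<close>

type_synonym ('o, 'a) multiplier = "('o, 'a) family \<times> ('o, 'a) family"

definition bounded_family :: "('o, 'a) ccat \<Rightarrow> ('o, 'a) family \<Rightarrow> bool" where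
  "bounded_family C F \<longleftrightarrow>
     (\<forall>\<rho>\<in>objs C. \<forall>\<sigma>\<in>objs C. linear_map (arrs C \<rho> \<sigma>) (arrs C \<rho> \<sigma>) (F \<rho> \<sigma>)) \<and>
     (\<exists>K. \<forall>\<rho>\<in>objs C. \<forall>\<sigma>\<in>objs C. \<forall>t\<in>hom C \<rho> \<sigma>.
        vnorm (arrs C \<rho> \<sigma>) (F \<rho> \<sigma> t) \<le> K * vnorm (arrs C \<rho> \<sigma>) t)"

definition left_multiplier :: "('o, 'a) ccat \<Rightarrow> ('o, 'a) family \<Rightarrow> bool" where
  "left_multiplier C F \<longleftrightarrow> bounded_family C F \<and>
     (\<forall>\<rho>\<in>objs C. \<forall>\<sigma>\<in>objs C. \<forall>\<tau>\<in>objs C. \<forall>t'\<in>hom C \<rho> \<sigma>. \<forall>t\<in>hom C \<sigma> \<tau>.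
        F \<rho> \<tau> (comp C \<rho> \<sigma> \<tau> t t') = comp C \<rho> \<sigma> \<tau> (F \<sigma> \<tau> t) t')"

definition right_multiplier :: "('o, 'a) ccat \<Rightarrow> ('o, 'a) family \<Rightarrow> bool" where
  "right_multiplier C F \<longleftrightarrow> bounded_family C F \<and>
     (\<forall>\<rho>\<in>objs C. \<forall>\<sigma>\<in>objs C. \<forall>\<tau>\<in>objs C. \<forall>t'\<in>hom C \<rho> \<sigma>. \<forall>t\<in>hom C \<sigma> \<tau>.
        F \<rho> \<tau> (comp C \<rho> \<sigma> \<tau> t t') = comp C \<rho> \<sigma> \<tau> t (F \<rho> \<sigma> t'))"

definition is_multiplier :: "('o, 'a) ccat \<Rightarrow> ('o, 'a) multiplier \<Rightarrow> bool" where
  "is_multiplier C F \<longleftrightarrow> left_multiplier C (fst F) \<and> right_multiplier C (snd F) \<and>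
     (\<forall>\<rho>\<in>objs C. \<forall>\<sigma>\<in>objs C. \<forall>\<tau>\<in>objs C. \<forall>t'\<in>hom C \<rho> \<sigma>. \<forall>t\<in>hom C \<sigma> \<tau>.
        comp C \<rho> \<sigma> \<tau> t (fst F \<rho> \<sigma> t') = comp C \<rho> \<sigma> \<tau> (snd F \<sigma> \<tau> t) t')"

definition mult_eq :: "('o, 'a) ccat \<Rightarrow> ('o, 'a) multiplier \<Rightarrow> ('o, 'a) multiplier \<Rightarrow> bool" where
  "mult_eq C F G \<longleftrightarrow> (\<forall>\<rho>\<in>objs C. \<forall>\<sigma>\<in>objs C. \<forall>t\<in>hom C \<rho> \<sigma>.
     fst F \<rho> \<sigma> t = fst G \<rho> \<sigma> t \<and> snd F \<rho> \<sigma> t = snd G \<rho> \<sigma> t)"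

definition mult_one :: "('o, 'a) multiplier" where
  "mult_one = (\<lambda>\<rho> \<sigma> t. t, \<lambda>\<rho> \<sigma> t. t)"

definition mult_add :: "('o, 'a) ccat \<Rightarrow> ('o, 'a) multiplier \<Rightarrow> ('o, 'a) multiplier \<Rightarrow>
    ('o, 'a) multiplier" where
  "mult_add C F G =
     (\<lambda>\<rho> \<sigma> t. vadd (arrs C \<rho> \<sigma>) (fst F \<rho> \<sigma> t) (fst G \<rho> \<sigma> t),
      \<lambda>\<rho> \<sigma> t. vadd (arrs C \<rho> \<sigma>) (snd F \<rho> \<sigma> t) (snd G \<rho> \<sigma> t))"

definition mult_scale :: "('o, 'a) ccat \<Rightarrow> complex \<Rightarrow> ('o, 'a) multiplier \<Rightarrow>
    ('o, 'a) multiplier" where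
  "mult_scale C c F =
     (\<lambda>\<rho> \<sigma> t. vscale (arrs C \<rho> \<sigma>) c (fst F \<rho> \<sigma> t),
      \<lambda>\<rho> \<sigma> t. vscale (arrs C \<rho> \<sigma>) c (snd F \<rho> \<sigma> t))"

definition mult_prod :: "('o, 'a) multiplier \<Rightarrow> ('o, 'a) multiplier \<Rightarrow> ('o, 'a) multiplier" where
  "mult_prod F G =
     (\<lambda>\<rho> \<sigma> t. fst F \<rho> \<sigma> (fst G \<rho> \<sigma> t), \<lambda>\<rho> \<sigma> t. snd G \<rho> \<sigma> (snd F \<rho> \<sigma> t))"

definition mult_star :: "('o, 'a) ccat \<Rightarrow> ('o, 'a) multiplier \<Rightarrow> ('o, 'a) multiplier" where
  "mult_star C F =
     (\<lambda>\<rho> \<sigma> t. star C \<sigma> \<rho> (snd F \<sigma> \<rho> (star C \<rho> \<sigma> t)),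
      \<lambda>\<rho> \<sigma> t. star C \<sigma> \<rho> (fst F \<sigma> \<rho> (star C \<rho> \<sigma> t)))"

text \<open>The elements of \<open>Z(C)\<close>.\<close>

definition central_multiplier :: "('o, 'a) ccat \<Rightarrow> ('o, 'a) multiplier \<Rightarrow> bool" where
  "central_multiplier C Z \<longleftrightarrow> is_multiplier C Z \<and>
     (\<forall>\<rho>\<in>objs C. \<forall>\<sigma>\<in>objs C. \<forall>t\<in>hom C \<rho> \<sigma>. fst Z \<rho> \<sigma> t = snd Z \<rho> \<sigma> t)"


section \<open>C(X)-categories\<close>

definition cont_fun :: "'x topology \<Rightarrow> ('x \<Rightarrow> complex) set" where
  "cont_fun X = {f \<in> extensional (topspace X). continuous_map X euclidean f}"

text \<open>\<open>\<phi>\<close> is the unital homomorphism of C*-algebras, that is, unital \<open>*\<close>-homomorphism, from \<open>C(X)\<close>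
  to \<open>Z(C)\<close>.\<close>

locale CX_category =
  fixes X :: "'x topology" and C :: "('o, 'a) ccat" and \<phi> :: "('x \<Rightarrow> complex) \<Rightarrow> ('o, 'a) multiplier"
  assumes category: "cstar_category C"
    and central: "f \<in> cont_fun X \<Longrightarrow> central_multiplier C (\<phi> f)"
    and hom_one: "mult_eq C (\<phi> (\<lambda>x\<in>topspace X. 1)) mult_one"
    and hom_add: "\<lbrakk>f \<in> cont_fun X; g \<in> cont_fun X\<rbrakk>
      \<Longrightarrow> mult_eq C (\<phi> (\<lambda>x\<in>topspace X. f x + g x)) (mult_add C (\<phi> f) (\<phi> g))"
    and hom_scale: "f \<in> cont_fun X
      \<Longrightarrow> mult_eq C (\<phi> (\<lambda>x\<in>topspace X. c * f x)) (mult_scale C c (\<phi> f))"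
    and hom_mult: "\<lbrakk>f \<in> cont_fun X; g \<in> cont_fun X\<rbrakk>
      \<Longrightarrow> mult_eq C (\<phi> (\<lambda>x\<in>topspace X. f x * g x)) (mult_prod (\<phi> f) (\<phi> g))"
    and hom_star: "f \<in> cont_fun X
      \<Longrightarrow> mult_eq C (\<phi> (\<lambda>x\<in>topspace X. cnj (f x))) (mult_star C (\<phi> f))"


section \<open>Fibers\<close>

text \<open>The ideal of \<open>(\<rho>,\<rho>)\<close> generated by the functions vanishing at \<open>x\<close>: a product of a C*-algebra
  with an ideal of \<open>C(X)\<close> is understood, as usual, as a closed linear span.\<close>

definition fiber_ideal :: "'x topology \<Rightarrow> ('o, 'a) ccat \<Rightarrow> (('x \<Rightarrow> complex) \<Rightarrow> ('o, 'a) multiplier) \<Rightarrow>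
    'x \<Rightarrow> 'o \<Rightarrow> 'a set" where
  "fiber_ideal X C \<phi> x \<rho> = closed_span (arrs C \<rho> \<rho>)
     {fst (\<phi> f) \<rho> \<rho> a | f a. f \<in> cont_fun X \<and> f x = 0 \<and> a \<in> hom C \<rho> \<rho>}"

text \<open>\<open>fiber_class X C \<phi> x \<rho>\<close> is the quotient map onto the C*-algebra \<open>(\<rho>,\<rho>)\<^sub>x\<close>, whose Banach
  space, product and involution are \<open>fiber_alg\<close>, \<open>fiber_alg_mult\<close> and \<open>fiber_alg_star\<close>.\<close>

definition fiber_class :: "'x topology \<Rightarrow> ('o, 'a) ccat \<Rightarrow> (('x \<Rightarrow> complex) \<Rightarrow> ('o, 'a) multiplier) \<Rightarrow>
    'x \<Rightarrow> 'o \<Rightarrow> 'a \<Rightarrow> 'a set" where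
  "fiber_class X C \<phi> x \<rho> = quot_class (arrs C \<rho> \<rho>) (fiber_ideal X C \<phi> x \<rho>)"

definition fiber_alg :: "'x topology \<Rightarrow> ('o, 'a) ccat \<Rightarrow> (('x \<Rightarrow> complex) \<Rightarrow> ('o, 'a) multiplier) \<Rightarrow>
    'x \<Rightarrow> 'o \<Rightarrow> 'a set cspace" where
  "fiber_alg X C \<phi> x \<rho> = quot_space (arrs C \<rho> \<rho>) (fiber_ideal X C \<phi> x \<rho>)"

definition fiber_alg_mult :: "'x topology \<Rightarrow> ('o, 'a) ccat \<Rightarrow>
    (('x \<Rightarrow> complex) \<Rightarrow> ('o, 'a) multiplier) \<Rightarrow> 'x \<Rightarrow> 'o \<Rightarrow> 'a set \<Rightarrow> 'a set \<Rightarrow> 'a set" where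
  "fiber_alg_mult X C \<phi> x \<rho> A B = fiber_class X C \<phi> x \<rho> (comp C \<rho> \<rho> \<rho> (rep A) (rep B))"

definition fiber_alg_star :: "'x topology \<Rightarrow> ('o, 'a) ccat \<Rightarrow>
    (('x \<Rightarrow> complex) \<Rightarrow> ('o, 'a) multiplier) \<Rightarrow> 'x \<Rightarrow> 'o \<Rightarrow> 'a set \<Rightarrow> 'a set" where
  "fiber_alg_star X C \<phi> x \<rho> A = fiber_class X C \<phi> x \<rho> (star C \<rho> \<rho> (rep A))"

type_synonym 'a fiber_arrow = "(nat \<Rightarrow> ('a \<times> 'a set) list) set"

text \<open>\<open>(\<rho>,\<sigma>)\<^sub>x\<close> is the tensor product over \<open>(\<rho>,\<rho>)\<close> of \<open>(\<rho>,\<sigma>)\<close>, with scalar product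
  \<open>\<langle>t,t'\<rangle> = t* \<circ> t'\<close>, and \<open>(\<rho>,\<rho>)\<^sub>x\<close>, with scalar product \<open>\<langle>A,B\<rangle> = A* B\<close> and left action through
  the quotient map.\<close>

definition fiber_pre :: "'x topology \<Rightarrow> ('o, 'a) ccat \<Rightarrow> (('x \<Rightarrow> complex) \<Rightarrow> ('o, 'a) multiplier) \<Rightarrow>
    'x \<Rightarrow> 'o \<Rightarrow> 'o \<Rightarrow> ('a \<times> 'a set) list cspace" where
  "fiber_pre X C \<phi> x \<rho> \<sigma> =
     pre_tensor (arrs C \<rho> \<sigma>) (\<lambda>t t'. comp C \<rho> \<sigma> \<rho> (star C \<rho> \<sigma> t) t')
       (fiber_alg X C \<phi> x \<rho>) (\<lambda>a. fiber_alg_mult X C \<phi> x \<rho> (fiber_class X C \<phi> x \<rho> a))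
       (\<lambda>A B. fiber_alg_mult X C \<phi> x \<rho> (fiber_alg_star X C \<phi> x \<rho> A) B)
       (fiber_alg X C \<phi> x \<rho>)"

definition fiber_arrs :: "'x topology \<Rightarrow> ('o, 'a) ccat \<Rightarrow> (('x \<Rightarrow> complex) \<Rightarrow> ('o, 'a) multiplier) \<Rightarrow>
    'x \<Rightarrow> 'o \<Rightarrow> 'o \<Rightarrow> 'a fiber_arrow cspace" where
  "fiber_arrs X C \<phi> x \<rho> \<sigma> = completion (fiber_pre X C \<phi> x \<rho> \<sigma>)"

text \<open>The canonical projection sends \<open>t\<close> to the elementary tensor of \<open>t\<close> with the unit of
  \<open>(\<rho>,\<rho>)\<^sub>x\<close>.\<close>

definition fiber_proj :: "'x topology \<Rightarrow> ('o, 'a) ccat \<Rightarrow> (('x \<Rightarrow> complex) \<Rightarrow> ('o, 'a) multiplier) \<Rightarrow>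
    'x \<Rightarrow> 'o \<Rightarrow> 'o \<Rightarrow> 'a \<Rightarrow> 'a fiber_arrow" where
  "fiber_proj X C \<phi> x \<rho> \<sigma> t =
     compl_class (fiber_pre X C \<phi> x \<rho> \<sigma>) (\<lambda>n. [(t, fiber_class X C \<phi> x \<rho> (ident C \<rho>))])"

text \<open>Composition and involution are induced by the canonical projections: they are the unique
  operations compatible with them.\<close>

definition fiber_comp :: "'x topology \<Rightarrow> ('o, 'a) ccat \<Rightarrow> (('x \<Rightarrow> complex) \<Rightarrow> ('o, 'a) multiplier) \<Rightarrow>
    'x \<Rightarrow> 'o \<Rightarrow> 'o \<Rightarrow> 'o \<Rightarrow> 'a fiber_arrow \<Rightarrow> 'a fiber_arrow \<Rightarrow> 'a fiber_arrow" where
  "fiber_comp X C \<phi> x \<rho> \<sigma> \<tau> u u' =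
     (THE w. \<exists>t\<in>hom C \<sigma> \<tau>. \<exists>t'\<in>hom C \<rho> \<sigma>.
        u = fiber_proj X C \<phi> x \<sigma> \<tau> t \<and> u' = fiber_proj X C \<phi> x \<rho> \<sigma> t' \<and>
        w = fiber_proj X C \<phi> x \<rho> \<tau> (comp C \<rho> \<sigma> \<tau> t t'))"

definition fiber_star :: "'x topology \<Rightarrow> ('o, 'a) ccat \<Rightarrow> (('x \<Rightarrow> complex) \<Rightarrow> ('o, 'a) multiplier) \<Rightarrow>
    'x \<Rightarrow> 'o \<Rightarrow> 'o \<Rightarrow> 'a fiber_arrow \<Rightarrow> 'a fiber_arrow" where
  "fiber_star X C \<phi> x \<rho> \<sigma> u =
     (THE w. \<exists>t\<in>hom C \<rho> \<sigma>.
        u = fiber_proj X C \<phi> x \<rho> \<sigma> t \<and> w = fiber_proj X C \<phi> x \<sigma> \<rho> (star C \<rho> \<sigma> t))"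

definition fiber_category :: "'x topology \<Rightarrow> ('o, 'a) ccat \<Rightarrow>
    (('x \<Rightarrow> complex) \<Rightarrow> ('o, 'a) multiplier) \<Rightarrow> 'x \<Rightarrow> ('o \<times> 'x, 'a fiber_arrow) ccat" where
  "fiber_category X C \<phi> x =
    \<lparr>objs = objs C \<times> {x},
     arrs = (\<lambda>(\<rho>, _) (\<sigma>, _). fiber_arrs X C \<phi> x \<rho> \<sigma>),
     comp = (\<lambda>(\<rho>, _) (\<sigma>, _) (\<tau>, _). fiber_comp X C \<phi> x \<rho> \<sigma> \<tau>),
     ident = (\<lambda>(\<rho>, _). fiber_proj X C \<phi> x \<rho> \<rho> (ident C \<rho>)),
     star = (\<lambda>(\<rho>, _) (\<sigma>, _). fiber_star X C \<phi> x \<rho> \<sigma>)\<rparr>"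

definition upper_semicontinuous_on :: "'x topology \<Rightarrow> ('x \<Rightarrow> real) \<Rightarrow> bool" where
  "upper_semicontinuous_on X n \<longleftrightarrow> (\<forall>c. openin X {x \<in> topspace X. n x < c})"

end

(* The norm of the fiber at x is computed without spectral theory or positivity.  Writing g for
   continuous functions with values in [0,1] that equal 1 near x, put n_x(t) = inf_g |g t|.  Since
   |g^2 t*t| = |g t|^2, this is a C*-seminorm on the arrows; its kernel on (rho,rho) is the fiber
   ideal, its quotient norm is the norm of (rho,rho)_x, and the seminorm of an element of the
   algebraic tensor product is n_x of the arrow obtained by composing the tensor factors.  Hence the
   tensor product is already complete and the projection (rho,sigma) -> (rho,sigma)_x is onto with
   kernel n_x = 0.  Semicontinuity is immediate, and the norm formula follows from compactness, a
   partition of unity and high powers of t*t. *)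

theory Submission
  imports Defs
begin

section \<open>Normed spaces with explicit carrier\<close>

text \<open>Positivity of \<open>star t\<close> composed with \<open>t\<close> is not among the
  axioms of \<open>cstar_category\<close>: the C*-identity is the only link between norm and
  involution. Even contractivity of the action of C(X) has to be derived: \<open>\<phi>\<close> is
  only a unital star-homomorphism, and each multiplier comes with its own bound. Unimodular
  functions act isometrically by the C*-identity, and other functions are reduced to them. Bumps
  make the classes of the fiber accessible: \<open>1 - g\<close> vanishes at \<open>x\<close>, so
  the truncation of \<open>t\<close> by \<open>g\<close> represents the same class as
  \<open>t\<close>, and an infimum over bumps is an infimum over representatives. Since square roots
  of bumps are bumps, this infimum inherits the C*-identity. The tensor product collapses because
  the tensor of \<open>e\<close> with the class of \<open>a\<close> equals the tensor of the
  composite of \<open>e\<close> and \<open>a\<close> with the unit.\<close>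

locale complex_normed =
  fixes V :: "'v cspace"
  assumes zero_closed [simp]: "vzero V \<in> vecs V"
    and add_closed [simp]: "\<lbrakk>u \<in> vecs V; v \<in> vecs V\<rbrakk> \<Longrightarrow> vadd V u v \<in> vecs V"
    and scale_closed [simp]: "v \<in> vecs V \<Longrightarrow> vscale V c v \<in> vecs V"
    and add_assoc: "\<lbrakk>u \<in> vecs V; v \<in> vecs V; w \<in> vecs V\<rbrakk>
      \<Longrightarrow> vadd V (vadd V u v) w = vadd V u (vadd V v w)"
    and add_commute: "\<lbrakk>u \<in> vecs V; v \<in> vecs V\<rbrakk> \<Longrightarrow> vadd V u v = vadd V v u"
    and add_zero [simp]: "v \<in> vecs V \<Longrightarrow> vadd V (vzero V) v = v"
    and diff_self [simp]: "v \<in> vecs V \<Longrightarrow> vdiff V v v = vzero V"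
    and scale_add: "\<lbrakk>u \<in> vecs V; v \<in> vecs V\<rbrakk>
      \<Longrightarrow> vscale V c (vadd V u v) = vadd V (vscale V c u) (vscale V c v)"
    and add_scale: "v \<in> vecs V \<Longrightarrow> vscale V (c + d) v = vadd V (vscale V c v) (vscale V d v)"
    and scale_scale [simp]: "v \<in> vecs V \<Longrightarrow> vscale V c (vscale V d v) = vscale V (c * d) v"
    and scale_one [simp]: "v \<in> vecs V \<Longrightarrow> vscale V 1 v = v"
    and norm_nonneg [simp]: "v \<in> vecs V \<Longrightarrow> 0 \<le> vnorm V v"
    and norm_eq_zero: "v \<in> vecs V \<Longrightarrow> vnorm V v = 0 \<longleftrightarrow> v = vzero V"
    and norm_add: "\<lbrakk>u \<in> vecs V; v \<in> vecs V\<rbrakk> \<Longrightarrow> vnorm V (vadd V u v) \<le> vnorm V u + vnorm V v"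
    and norm_scale: "v \<in> vecs V \<Longrightarrow> vnorm V (vscale V c v) = cmod c * vnorm V v"
begin

lemma diff_closed [simp]: "\<lbrakk>u \<in> vecs V; v \<in> vecs V\<rbrakk> \<Longrightarrow> vdiff V u v \<in> vecs V"
  by (simp add: vdiff_def)

lemma add_left_commute:
  "\<lbrakk>u \<in> vecs V; v \<in> vecs V; w \<in> vecs V\<rbrakk> \<Longrightarrow> vadd V u (vadd V v w) = vadd V v (vadd V u w)"
  by (metis add_assoc add_commute)

lemmas add_ac = add_assoc add_commute add_left_commute

lemma add_zero_right [simp]: "v \<in> vecs V \<Longrightarrow> vadd V v (vzero V) = v"
  using add_commute by force

lemma add_neg_self [simp]: "v \<in> vecs V \<Longrightarrow> vadd V v (vscale V (- 1) v) = vzero V"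
  using diff_self by (simp add: vdiff_def)

lemma add_neg_cancel [simp]:
  "\<lbrakk>v \<in> vecs V; w \<in> vecs V\<rbrakk> \<Longrightarrow> vadd V v (vadd V (vscale V (- 1) v) w) = w"
  by (simp flip: add_assoc)

lemma neg_add_cancel [simp]:
  "\<lbrakk>v \<in> vecs V; w \<in> vecs V\<rbrakk> \<Longrightarrow> vadd V (vscale V (- 1) v) (vadd V v w) = w"
  by (simp add: add_left_commute[of "vscale V (- 1) v" v w])

lemma add_left_cancel:
  assumes "u \<in> vecs V" "v \<in> vecs V" "w \<in> vecs V" "vadd V u v = vadd V u w"
  shows "v = w"
  by (metis assms neg_add_cancel)

lemma scale_zero_left [simp]: "v \<in> vecs V \<Longrightarrow> vscale V 0 v = vzero V"
  using add_left_cancel[of "vscale V 0 v" "vscale V 0 v" "vzero V"] add_scale[of v 0 0] by simp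

lemma scale_zero_right [simp]: "vscale V c (vzero V) = vzero V"
  by (metis scale_zero_left scale_scale zero_closed mult_zero_right)

lemma norm_zero [simp]: "vnorm V (vzero V) = 0"
  by (simp add: norm_eq_zero)

lemma diff_zero [simp]: "v \<in> vecs V \<Longrightarrow> vdiff V v (vzero V) = v"
  by (simp add: vdiff_def)

lemma diff_add_diff:
  "\<lbrakk>u \<in> vecs V; v \<in> vecs V; w \<in> vecs V\<rbrakk> \<Longrightarrow> vadd V (vdiff V u v) (vdiff V v w) = vdiff V u w"
  by (simp add: vdiff_def add_ac)

lemma diff_add_cancel: "\<lbrakk>u \<in> vecs V; v \<in> vecs V\<rbrakk> \<Longrightarrow> vadd V (vdiff V u v) v = u"
  using add_commute add_neg_cancel by (simp add: vdiff_def add_assoc)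

lemma add_diff_add:
  "\<lbrakk>u \<in> vecs V; v \<in> vecs V; w \<in> vecs V; z \<in> vecs V\<rbrakk>
    \<Longrightarrow> vdiff V (vadd V u v) (vadd V w z) = vadd V (vdiff V u w) (vdiff V v z)"
  by (simp add: vdiff_def scale_add add_ac)

lemma scale_diff:
  "\<lbrakk>u \<in> vecs V; v \<in> vecs V\<rbrakk> \<Longrightarrow> vdiff V (vscale V c u) (vscale V c v) = vscale V c (vdiff V u v)"
  by (simp add: vdiff_def scale_add)

lemma neg_diff: "\<lbrakk>u \<in> vecs V; v \<in> vecs V\<rbrakk> \<Longrightarrow> vscale V (- 1) (vdiff V u v) = vdiff V v u"
  by (simp add: vdiff_def scale_add add_ac)

lemma diff_eq_zero_iff: "\<lbrakk>u \<in> vecs V; v \<in> vecs V\<rbrakk> \<Longrightarrow> vdiff V u v = vzero V \<longleftrightarrow> u = v"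
  by (metis add_zero diff_add_cancel diff_self)

lemma norm_diff_commute: "\<lbrakk>u \<in> vecs V; v \<in> vecs V\<rbrakk> \<Longrightarrow> vnorm V (vdiff V u v) = vnorm V (vdiff V v u)"
  using norm_scale[of "vdiff V u v" "- 1"] by (simp add: neg_diff)

lemma norm_diff_triangle:
  "\<lbrakk>u \<in> vecs V; v \<in> vecs V; w \<in> vecs V\<rbrakk>
    \<Longrightarrow> vnorm V (vdiff V u w) \<le> vnorm V (vdiff V u v) + vnorm V (vdiff V v w)"
  by (metis diff_add_diff diff_closed norm_add)

lemma foldr_add_closed:
  "set xs \<subseteq> vecs V \<Longrightarrow> foldr (vadd V) xs (vzero V) \<in> vecs V"
  by (induction xs) auto

lemma foldr_add_append:
  "\<lbrakk>set xs \<subseteq> vecs V; set ys \<subseteq> vecs V\<rbrakk> \<Longrightarrow> foldr (vadd V) (xs @ ys) (vzero V) =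
     vadd V (foldr (vadd V) xs (vzero V)) (foldr (vadd V) ys (vzero V))"
  by (induction xs) (auto simp: foldr_add_closed add_assoc simp del: foldr_append)

section \<open>Completeness and closedness in terms of the norm\<close>

lemma Metric_space_vecs:
  "Metric_space (vecs V)
     (\<lambda>u v. if u \<in> vecs V \<and> v \<in> vecs V then vnorm V (vdiff V u v) else 0)"
  by unfold_locales (auto simp: norm_diff_commute norm_eq_zero diff_eq_zero_iff norm_diff_triangle)

text \<open>Cauchy sequences and their limits lie in the carrier, so the default distance 0 off the
  carrier never enters.\<close>

lemma mcomplete_of_vmetric_iff:
  "mcomplete_of (vmetric V) \<longleftrightarrow>
     (\<forall>s. cauchy_seq V s \<longrightarrow> (\<exists>v\<in>vecs V. (\<lambda>n. vnorm V (vdiff V (s n) v)) \<longlonglongrightarrow> 0))"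
proof -
  interpret M: Metric_space "vecs V"
    "\<lambda>u v. if u \<in> vecs V \<and> v \<in> vecs V then vnorm V (vdiff V u v) else 0"
    by (rule Metric_space_vecs)
  have c: "M.MCauchy s \<longleftrightarrow> cauchy_seq V s" for s
    unfolding M.MCauchy_def cauchy_seq_def by (auto simp: subset_eq)
  have l: "limitin M.mtopology s v sequentially \<longleftrightarrow>
      v \<in> vecs V \<and> (\<lambda>n. vnorm V (vdiff V (s n) v)) \<longlonglongrightarrow> 0" if "cauchy_seq V s" for s v
  proof -
    have "s n \<in> vecs V" for n
      using that by (auto simp: cauchy_seq_def)
    then show ?thesis
      unfolding M.limitin_metric_dist_null by (auto cong: conj_cong)
  qed
  show ?thesis
    unfolding vmetric_def M.mcomplete_of M.mcomplete_def c using l by auto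
qed

text \<open>Together with \<open>closedin_vmetricD\<close> this turns closedness into approximation
  in norm, the form in which kernels of seminorms and the closed span defining the fiber ideal are
  handled.\<close>

lemma closedin_vmetricI:
  assumes "W \<subseteq> vecs V"
    and "\<And>v. \<lbrakk>v \<in> vecs V; \<And>e. e > 0 \<Longrightarrow> \<exists>w\<in>W. vnorm V (vdiff V v w) < e\<rbrakk> \<Longrightarrow> v \<in> W"
  shows "closedin (mtopology_of (vmetric V)) W"
proof -
  interpret M: Metric_space "vecs V"
    "\<lambda>u v. if u \<in> vecs V \<and> v \<in> vecs V then vnorm V (vdiff V u v) else 0"
    by (rule Metric_space_vecs)
  show ?thesis
    unfolding vmetric_def M.mtopology_of M.closedin_metric
  proof (intro conjI allI impI assms(1))
    fix v assume v: "v \<in> vecs V - W"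
    then obtain e where "e > 0" "\<forall>w\<in>W. \<not> vnorm V (vdiff V v w) < e"
      using assms(2) by blast
    then show "\<exists>r>0. disjnt W (M.mball v r)"
      using v assms(1) by (intro exI[of _ e]) (auto simp: disjnt_iff subset_eq)
  qed
qed

lemma closedin_vmetricD:
  assumes "closedin (mtopology_of (vmetric V)) W" and "v \<in> vecs V"
    and "\<And>e. e > 0 \<Longrightarrow> \<exists>w\<in>W. vnorm V (vdiff V v w) < e"
  shows "v \<in> W"
proof (rule ccontr)
  interpret M: Metric_space "vecs V"
    "\<lambda>u v. if u \<in> vecs V \<and> v \<in> vecs V then vnorm V (vdiff V u v) else 0"
    by (rule Metric_space_vecs)
  assume "v \<notin> W"
  moreover have W: "W \<subseteq> vecs V" "\<forall>x. x \<in> vecs V - W \<longrightarrow> (\<exists>r>0. disjnt W (M.mball x r))"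
    using assms(1) unfolding vmetric_def M.mtopology_of M.closedin_metric by auto
  ultimately obtain r where "r > 0" "disjnt W (M.mball v r)"
    using assms(2) by blast
  then show False
    using assms(2) assms(3)[of r] W(1) by (auto simp: disjnt_iff subset_eq)
qed

end

sublocale complex_banach \<subseteq> complex_normed
  by (rule complex_normed.intro; rule zero_closed add_closed scale_closed add_assoc add_commute
      add_zero diff_self scale_add add_scale scale_scale scale_one norm_nonneg norm_eq_zero
      norm_add norm_scale)

lemma (in complex_banach) cauchy_limit:
  assumes "cauchy_seq V s"
  obtains v where "v \<in> vecs V" "(\<lambda>n. vnorm V (vdiff V (s n) v)) \<longlonglongrightarrow> 0"
  using assms complete mcomplete_of_vmetric_iff by blast

lemma (in complex_normed) complex_banachI:
  assumes "\<And>s. cauchy_seq V s \<Longrightarrow> \<exists>v\<in>vecs V. (\<lambda>n. vnorm V (vdiff V (s n) v)) \<longlonglongrightarrow> 0"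
  shows "complex_banach V"
  by (rule complex_banach.intro; (rule zero_closed add_closed scale_closed add_assoc add_commute
      add_zero diff_self scale_add add_scale scale_scale scale_one norm_nonneg norm_eq_zero
      norm_add norm_scale)?) (simp_all add: mcomplete_of_vmetric_iff assms)

section \<open>Quotient seminorms\<close>

text \<open>The last two assumptions say that \<open>n\<close> is the quotient norm of
  \<open>vnorm V\<close> modulo the null vectors of \<open>n\<close>: \<open>sn_le_norm\<close>
  bounds \<open>n v\<close> by the norm of every vector congruent to \<open>v\<close>, and
  \<open>sn_lift\<close> finds congruent vectors whose norm comes arbitrarily close.\<close>

locale quotient_seminorm = complex_banach V for V :: "'v cspace" +
  fixes n :: "'v \<Rightarrow> real"
  assumes sn_nonneg [simp]: "v \<in> vecs V \<Longrightarrow> 0 \<le> n v"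
    and sn_add: "\<lbrakk>u \<in> vecs V; v \<in> vecs V\<rbrakk> \<Longrightarrow> n (vadd V u v) \<le> n u + n v"
    and sn_scale: "v \<in> vecs V \<Longrightarrow> n (vscale V c v) = cmod c * n v"
    and sn_le_norm: "v \<in> vecs V \<Longrightarrow> n v \<le> vnorm V v"
    and sn_lift: "\<lbrakk>v \<in> vecs V; n v < e\<rbrakk> \<Longrightarrow> \<exists>w\<in>vecs V. vnorm V w < e \<and> n (vdiff V v w) = 0"
begin

definition sn_kernel :: "'v set" where
  "sn_kernel = {v \<in> vecs V. n v = 0}"

lemma sn_zero [simp]: "n (vzero V) = 0"
  using sn_scale[of "vzero V" 0] by simp

lemma sn_antisym: "\<lbrakk>v \<in> vecs V; n v \<le> 0\<rbrakk> \<Longrightarrow> n v = 0"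
  using sn_nonneg[of v] by linarith

lemma sn_diff_commute: "\<lbrakk>u \<in> vecs V; v \<in> vecs V\<rbrakk> \<Longrightarrow> n (vdiff V u v) = n (vdiff V v u)"
  using sn_scale[of "vdiff V u v" "- 1"] by (simp add: neg_diff)

lemma sn_diff_triangle:
  "\<lbrakk>u \<in> vecs V; v \<in> vecs V; w \<in> vecs V\<rbrakk> \<Longrightarrow> n (vdiff V u w) \<le> n (vdiff V u v) + n (vdiff V v w)"
  by (metis diff_add_diff diff_closed sn_add)

lemma sn_le_add_diff: "\<lbrakk>u \<in> vecs V; v \<in> vecs V\<rbrakk> \<Longrightarrow> n u \<le> n v + n (vdiff V u v)"
  by (metis add.commute diff_add_cancel diff_closed sn_add)

lemma sn_abs_diff: "\<lbrakk>u \<in> vecs V; v \<in> vecs V\<rbrakk> \<Longrightarrow> \<bar>n u - n v\<bar> \<le> n (vdiff V u v)"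
  using sn_le_add_diff[of u v] sn_le_add_diff[of v u] sn_diff_commute[of u v] by linarith

lemma sn_cong: "\<lbrakk>u \<in> vecs V; v \<in> vecs V; n (vdiff V u v) = 0\<rbrakk> \<Longrightarrow> n u = n v"
  using sn_abs_diff[of u v] by simp

lemma sn_diff_trans:
  "\<lbrakk>u \<in> vecs V; v \<in> vecs V; w \<in> vecs V; n (vdiff V u v) = 0; n (vdiff V v w) = 0\<rbrakk>
    \<Longrightarrow> n (vdiff V u w) = 0"
  using sn_diff_triangle[of u v w] sn_antisym[of "vdiff V u w"] by simp

lemma closed_subspace_sn_kernel: "closed_subspace V sn_kernel"
  unfolding closed_subspace_def
proof (intro conjI ballI allI)
  fix u v assume "u \<in> sn_kernel" "v \<in> sn_kernel"
  then show "vadd V u v \<in> sn_kernel"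
    using sn_add[of u v] sn_antisym[of "vadd V u v"] by (simp add: sn_kernel_def)
next
  show "closedin (mtopology_of (vmetric V)) sn_kernel"
  proof (rule closedin_vmetricI)
    fix v assume v: "v \<in> vecs V"
      and e: "\<And>e. e > 0 \<Longrightarrow> \<exists>w\<in>sn_kernel. vnorm V (vdiff V v w) < e"
    have "n v \<le> 0"
    proof (rule field_le_epsilon)
      fix e :: real assume "e > 0"
      then obtain w where w: "w \<in> vecs V" "n w = 0" "vnorm V (vdiff V v w) < e"
        using e by (auto simp: sn_kernel_def)
      then show "n v \<le> 0 + e"
        using sn_le_add_diff[of v w] sn_le_norm[of "vdiff V v w"] v by simp
    qed
    then show "v \<in> sn_kernel"
      using sn_nonneg[OF v] v by (simp add: sn_kernel_def)
  qed (auto simp: sn_kernel_def)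
qed (auto simp: sn_kernel_def sn_scale)

text \<open>The classical argument for quotients of Banach spaces: along a rapidly Cauchy
  subsequence the successive differences lift to vectors with summable norms, the lifted series
  converges in \<open>V\<close>, and its limit serves for the whole sequence.\<close>

lemma sn_complete:
  assumes s: "\<And>k. s k \<in> vecs V"
    and cauchy: "\<And>e. e > 0 \<Longrightarrow> \<exists>N. \<forall>i\<ge>N. \<forall>j\<ge>N. n (vdiff V (s i) (s j)) < e"
  shows "\<exists>v\<in>vecs V. (\<lambda>k. n (vdiff V (s k) v)) \<longlonglongrightarrow> 0"
proof -
  have "\<forall>k. \<exists>N. \<forall>i\<ge>N. \<forall>j\<ge>N. n (vdiff V (s i) (s j)) < (1/2)^k"
    using cauchy by simp
  then obtain N where N: "\<And>k i j. \<lbrakk>i \<ge> N k; j \<ge> N k\<rbrakk> \<Longrightarrow> n (vdiff V (s i) (s j)) < (1/2)^k"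
    by metis
  \<comment> \<open>Summing the thresholds puts both \<open>M k\<close> and \<open>M (Suc k)\<close>
    beyond \<open>N k\<close>; the summand \<open>k\<close> makes the indices tend to
    infinity.\<close>
  define M where "M k = (\<Sum>i\<le>k. N i) + k" for k
  have M: "M k \<ge> N k" "M (Suc k) \<ge> N k" "M k \<ge> k" for k
    using member_le_sum[of k "{..k}" N] by (auto simp: M_def)
  have "\<forall>k. \<exists>w\<in>vecs V. vnorm V w < (1/2)^k \<and> n (vdiff V (vdiff V (s (M (Suc k))) (s (M k))) w) = 0"
    using s M N by (intro allI sn_lift) auto
  then obtain w where w: "\<And>k. w k \<in> vecs V" "\<And>k. vnorm V (w k) < (1/2)^k"
      "\<And>k. n (vdiff V (vdiff V (s (M (Suc k))) (s (M k))) (w k)) = 0"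
    by metis
  \<comment> \<open>The partial sums of the lifts, started at \<open>s (M 0)\<close>: congruent to
    the subsequence modulo null vectors, but Cauchy for the norm itself.\<close>
  define r where "r = rec_nat (s (M 0)) (\<lambda>k v. vadd V (w k) v)"
  have r_Suc: "r (Suc k) = vadd V (w k) (r k)" for k
    by (simp add: r_def)
  have r: "r k \<in> vecs V" for k
    by (induction k) (auto simp: r_def s w)
  have sr: "n (vdiff V (s (M k)) (r k)) = 0" for k
  proof (induction k)
    case 0
    then show ?case by (simp add: r_def s)
  next
    case (Suc k)
    have "vdiff V (s (M (Suc k))) (r (Suc k)) =
        vdiff V (vadd V (vdiff V (s (M (Suc k))) (s (M k))) (s (M k))) (vadd V (w k) (r k))"
      by (simp add: r_Suc diff_add_cancel s)
    also have "\<dots> = vadd V (vdiff V (vdiff V (s (M (Suc k))) (s (M k))) (w k)) (vdiff V (s (M k)) (r k))"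
      using s w r by (intro add_diff_add) auto
    finally have "n (vdiff V (s (M (Suc k))) (r (Suc k))) \<le> 0"
      using sn_add[of "vdiff V (vdiff V (s (M (Suc k))) (s (M k))) (w k)" "vdiff V (s (M k)) (r k)"]
        w Suc s r by simp
    then show ?case
      using s r by (intro sn_antisym) auto
  qed
  \<comment> \<open>The exact geometric sum, not just the bound \<open>2 * (1/2)^k\<close>, is what
    the induction on \<open>i\<close> can carry.\<close>
  have tail: "vnorm V (vdiff V (r (k + i)) (r k)) \<le> 2 * (1/2)^k - 2 * (1/2)^(k+i)" for k i
  proof (induction i)
    case 0
    then show ?case using r by simp
  next
    case (Suc i)
    have "vdiff V (r (Suc (k + i))) (r (k + i)) = w (k + i)"
      using r w by (simp add: r_Suc vdiff_def add_assoc)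
    then have "vnorm V (vdiff V (r (k + Suc i)) (r k)) \<le>
        vnorm V (w (k + i)) + vnorm V (vdiff V (r (k + i)) (r k))"
      using norm_diff_triangle[of "r (Suc (k + i))" "r (k + i)" "r k"] r by simp
    then show ?case
      using Suc w(2)[of "k + i"] by simp
  qed
  have tail': "vnorm V (vdiff V (r j) (r k)) \<le> 2 * (1/2)^k" if "k \<le> j" for k j
    using tail[of k "j - k"] that zero_le_power[of "1/2::real" j]
    by (simp del: zero_le_power zero_le_power_eq)
  have "cauchy_seq V r"
    unfolding cauchy_seq_def
  proof (intro conjI allI impI)
    fix e :: real assume "e > 0"
    then obtain K where K: "(1/2)^K < e / 4"
      using real_arch_pow_inv[of "e/4" "1/2"] by auto
    have "vnorm V (vdiff V (r i) (r j)) < e" if "i \<ge> K" "j \<ge> K" for i j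
      using norm_diff_triangle[OF r[of i] r[of K] r[of j]] norm_diff_commute[OF r[of K] r[of j]]
        tail'[OF that(1)] tail'[OF that(2)] K by simp
    then show "\<exists>K. \<forall>i\<ge>K. \<forall>j\<ge>K. vnorm V (vdiff V (r i) (r j)) < e"
      by blast
  qed (use r in auto)
  then obtain v where v: "v \<in> vecs V" "(\<lambda>k. vnorm V (vdiff V (r k) v)) \<longlonglongrightarrow> 0"
    using cauchy_limit by blast
  have "(\<lambda>k. n (vdiff V (s k) v)) \<longlonglongrightarrow> 0"
  proof (rule LIMSEQ_I)
    fix e :: real assume "e > 0"
    then obtain K where K: "\<And>i j. \<lbrakk>i \<ge> K; j \<ge> K\<rbrakk> \<Longrightarrow> n (vdiff V (s i) (s j)) < e / 2"
      using cauchy[of "e/2"] by auto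
    obtain L where L: "\<And>k. k \<ge> L \<Longrightarrow> vnorm V (vdiff V (r k) v) < e / 2"
      using LIMSEQ_D[OF v(2), of "e/2"] \<open>e > 0\<close> v r by auto
    have "n (vdiff V (s k) v) < e" if "k \<ge> K" for k
    proof -
      \<comment> \<open>One index past both thresholds: \<open>M j\<close> is at least
        \<open>j\<close>, so \<open>s (M j)\<close> is close to \<open>s k\<close>, while
        \<open>r j\<close>, congruent to \<open>s (M j)\<close>, is close to
        \<open>v\<close>.\<close>
      define j where "j = max K L"
      have "n (vdiff V (s k) v) \<le> n (vdiff V (s k) (s (M j))) + n (vdiff V (s (M j)) v)"
        using s v by (intro sn_diff_triangle) auto
      also have "n (vdiff V (s (M j)) v) \<le> n (vdiff V (s (M j)) (r j)) + n (vdiff V (r j) v)"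
        using s v r by (intro sn_diff_triangle) auto
      also have "n (vdiff V (r j) v) \<le> vnorm V (vdiff V (r j) v)"
        using r v by (intro sn_le_norm) auto
      also have "\<dots> < e / 2"
        by (rule L) (simp add: j_def)
      also have "n (vdiff V (s k) (s (M j))) < e / 2"
        using that M(3)[of j] by (intro K) (auto simp: j_def)
      finally show ?thesis
        using sr by simp
    qed
    then show "\<exists>K. \<forall>k\<ge>K. norm (n (vdiff V (s k) v) - 0) < e"
      using s v by auto
  qed
  then show ?thesis
    using v by blast
qed

text \<open>Serves both for the quotient and for the completion, each an image of \<open>V\<close>
  with norm \<open>n\<close>. The converse of \<open>eq\<close> follows from \<open>norm\<close>,
  and completeness follows by lifting a Cauchy sequence through \<open>p\<close> and applying
  \<open>sn_complete\<close>.\<close>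

lemma banach_image:
  assumes vecs: "vecs W = p ` vecs V"
    and zero: "vzero W = p (vzero V)"
    and add: "\<And>u v. \<lbrakk>u \<in> vecs V; v \<in> vecs V\<rbrakk> \<Longrightarrow> vadd W (p u) (p v) = p (vadd V u v)"
    and scale: "\<And>c v. v \<in> vecs V \<Longrightarrow> vscale W c (p v) = p (vscale V c v)"
    and norm: "\<And>v. v \<in> vecs V \<Longrightarrow> vnorm W (p v) = n v"
    and eq: "\<And>v. \<lbrakk>v \<in> vecs V; n v = 0\<rbrakk> \<Longrightarrow> p v = p (vzero V)"
  shows "complex_banach W"
proof -
  have diff: "vdiff W (p u) (p v) = p (vdiff V u v)" if "u \<in> vecs V" "v \<in> vecs V" for u v
    using that by (simp add: vdiff_def add scale)
  interpret W: complex_normed W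
  proof
    fix A B D assume "A \<in> vecs W" "B \<in> vecs W" "D \<in> vecs W"
    then show "vadd W (vadd W A B) D = vadd W A (vadd W B D)"
      by (auto simp: vecs add add_assoc)
  next
    fix A B assume "A \<in> vecs W" "B \<in> vecs W"
    then show "vadd W A B = vadd W B A"
      using add_commute by (force simp: vecs add)
  next
    fix A assume "A \<in> vecs W"
    then obtain v where "v \<in> vecs V" "A = p v"
      by (auto simp: vecs)
    then show "vdiff W A A = vzero W" "vnorm W A = 0 \<longleftrightarrow> A = vzero W"
      using eq[of v] norm[of v] norm[of "vzero V"] by (auto simp: diff zero)
    show "vnorm W (vscale W c A) = cmod c * vnorm W A" for c
      using \<open>v \<in> vecs V\<close> \<open>A = p v\<close> by (simp add: scale norm sn_scale)
  qed (auto simp: vecs zero add scale norm sn_add scale_add add_scale)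
  show ?thesis
  proof (rule W.complex_banachI)
    fix s assume s: "cauchy_seq W s"
    then have "\<forall>k. \<exists>v\<in>vecs V. s k = p v"
      unfolding cauchy_seq_def vecs by blast
    then obtain r where r: "\<And>k. r k \<in> vecs V" "\<And>k. s k = p (r k)"
      by metis
    have "\<exists>v\<in>vecs V. (\<lambda>k. n (vdiff V (r k) v)) \<longlonglongrightarrow> 0"
      using s by (intro sn_complete) (auto simp: cauchy_seq_def r diff norm)
    then show "\<exists>A\<in>vecs W. (\<lambda>k. vnorm W (vdiff W (s k) A)) \<longlonglongrightarrow> 0"
      by (auto simp: r diff norm vecs)
  qed
qed

end

lemma rep_in: "a \<in> A \<Longrightarrow> rep A \<in> A"
  unfolding rep_def by (rule someI)

section \<open>The quotient by the null vectors\<close>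

context quotient_seminorm
begin

abbreviation cls :: "'v \<Rightarrow> 'v set" where
  "cls \<equiv> quot_class V sn_kernel"

lemma mem_cls_iff: "v \<in> vecs V \<Longrightarrow> w \<in> cls v \<longleftrightarrow> w \<in> vecs V \<and> n (vdiff V w v) = 0"
  by (auto simp: quot_class_def sn_kernel_def)

lemma mem_cls_self: "v \<in> vecs V \<Longrightarrow> v \<in> cls v"
  by (simp add: mem_cls_iff)

lemma cls_eq_iff:
  assumes "u \<in> vecs V" "v \<in> vecs V"
  shows "cls u = cls v \<longleftrightarrow> n (vdiff V u v) = 0"
proof
  assume "cls u = cls v"
  then show "n (vdiff V u v) = 0"
    using mem_cls_iff mem_cls_self assms by blast
next
  assume uv: "n (vdiff V u v) = 0"
  have "w \<in> cls u \<longleftrightarrow> w \<in> cls v" for w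
    using assms uv sn_diff_trans[of w u v] sn_diff_trans[of w v u] sn_diff_commute[of u v]
    by (auto simp: mem_cls_iff)
  then show "cls u = cls v"
    by blast
qed

lemma rep_cls:
  assumes "v \<in> vecs V"
  shows "rep (cls v) \<in> vecs V" "n (vdiff V (rep (cls v)) v) = 0"
  using rep_in[OF mem_cls_self[OF assms]] assms by (auto simp: mem_cls_iff)

lemma rep_quotient:
  assumes "A \<in> vecs (quot_space V sn_kernel)"
  shows "rep A \<in> vecs V" "cls (rep A) = A"
proof -
  obtain v where "v \<in> vecs V" "A = cls v"
    using assms by (auto simp: quot_space_def)
  then show "rep A \<in> vecs V" "cls (rep A) = A"
    using rep_cls[of v] by (auto simp: cls_eq_iff)
qed

lemma vecs_quotient: "vecs (quot_space V sn_kernel) = cls ` vecs V"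
  and vzero_quotient: "vzero (quot_space V sn_kernel) = cls (vzero V)"
  by (simp_all add: quot_space_def)

lemma sn_add_diff_add:
  assumes "u \<in> vecs V" "u' \<in> vecs V" "v \<in> vecs V" "v' \<in> vecs V"
    and "n (vdiff V u u') = 0" "n (vdiff V v v') = 0"
  shows "n (vdiff V (vadd V u v) (vadd V u' v')) = 0"
  using assms sn_add[of "vdiff V u u'" "vdiff V v v'"] sn_antisym
  by (simp add: add_diff_add)

lemma vadd_quotient:
  assumes "u \<in> vecs V" "v \<in> vecs V"
  shows "vadd (quot_space V sn_kernel) (cls u) (cls v) = cls (vadd V u v)"
  using assms by (simp add: quot_space_def rep_cls cls_eq_iff sn_add_diff_add)

lemma vscale_quotient:
  assumes "v \<in> vecs V"
  shows "vscale (quot_space V sn_kernel) c (cls v) = cls (vscale V c v)"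
  using assms by (simp add: quot_space_def rep_cls cls_eq_iff scale_diff sn_scale)

text \<open>All members of the class have the same \<open>n\<close>, which is a lower bound of their
  norms by \<open>sn_le_norm\<close>; \<open>sn_lift\<close> supplies members that come arbitrarily
  close to it.\<close>

lemma vnorm_quotient:
  assumes v: "v \<in> vecs V"
  shows "vnorm (quot_space V sn_kernel) (cls v) = n v"
proof -
  have "Inf (vnorm V ` cls v) = n v"
  proof (rule cInf_eq_non_empty)
    show "vnorm V ` cls v \<noteq> {}"
      using mem_cls_self[OF v] by auto
    show "n v \<le> r" if r: "r \<in> vnorm V ` cls v" for r
    proof -
      obtain w where "w \<in> vecs V" "n (vdiff V w v) = 0" "r = vnorm V w"
        using r v by (auto simp: mem_cls_iff)
      then show ?thesis
        using sn_le_norm[of w] sn_cong[of w v] v by simp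
    qed
    show "y \<le> n v" if y: "\<And>r. r \<in> vnorm V ` cls v \<Longrightarrow> y \<le> r" for y
    proof (rule field_le_epsilon)
      fix e :: real assume "e > 0"
      then obtain w where "w \<in> vecs V" "vnorm V w < n v + e" "n (vdiff V v w) = 0"
        using sn_lift[of v "n v + e"] v by auto
      moreover from this have "w \<in> cls v"
        using v by (simp add: mem_cls_iff sn_diff_commute)
      ultimately show "y \<le> n v + e"
        using y[of "vnorm V w"] by auto
    qed
  qed
  then show ?thesis
    by (simp add: quot_space_def)
qed

lemma banach_quotient: "complex_banach (quot_space V sn_kernel)"
  by (rule banach_image[where p = cls])
    (simp_all add: vecs_quotient vzero_quotient vadd_quotient vscale_quotient vnorm_quotient
      cls_eq_iff)

end

text \<open>\<open>P\<close> satisfies the vector space laws only modulo null vectors; \<open>elem\<close> inverts \<open>eval\<close> up to null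
  vectors, so that the completion of \<open>P\<close> is the quotient of \<open>V\<close> by the kernel of the seminorm.\<close>

locale seminorm_presentation = quotient_seminorm V n for V :: "'v cspace" and n +
  fixes P :: "'p cspace" and eval :: "'p \<Rightarrow> 'v" and elem :: "'v \<Rightarrow> 'p"
  assumes P_zero: "vzero P \<in> vecs P"
    and P_add: "\<lbrakk>z \<in> vecs P; z' \<in> vecs P\<rbrakk> \<Longrightarrow> vadd P z z' \<in> vecs P"
    and P_scale: "z \<in> vecs P \<Longrightarrow> vscale P c z \<in> vecs P"
    and eval_closed [simp]: "z \<in> vecs P \<Longrightarrow> eval z \<in> vecs V"
    and eval_zero: "eval (vzero P) = vzero V"
    and eval_add: "\<lbrakk>z \<in> vecs P; z' \<in> vecs P\<rbrakk> \<Longrightarrow> eval (vadd P z z') = vadd V (eval z) (eval z')"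
    and eval_scale: "z \<in> vecs P \<Longrightarrow> eval (vscale P c z) = vscale V c (eval z)"
    and vnorm_P: "z \<in> vecs P \<Longrightarrow> vnorm P z = n (eval z)"
    and elem_closed [simp]: "v \<in> vecs V \<Longrightarrow> elem v \<in> vecs P"
    and eval_elem: "v \<in> vecs V \<Longrightarrow> n (vdiff V (eval (elem v)) v) = 0"
begin

section \<open>The completion of a presentation\<close>

lemma vnorm_vdiff_P:
  "\<lbrakk>z \<in> vecs P; z' \<in> vecs P\<rbrakk> \<Longrightarrow> vnorm P (vdiff P z z') = n (vdiff V (eval z) (eval z'))"
  by (simp add: vdiff_def vnorm_P P_add P_scale eval_add eval_scale)

definition converges :: "(nat \<Rightarrow> 'p) \<Rightarrow> 'v \<Rightarrow> bool" where
  "converges s v \<longleftrightarrow> range s \<subseteq> vecs P \<and> (\<lambda>k. n (vdiff V (eval (s k)) v)) \<longlonglongrightarrow> 0"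

lemma converges_closed: "converges s v \<Longrightarrow> s k \<in> vecs P"
  by (auto simp: converges_def)

lemma converges_const: "\<lbrakk>z \<in> vecs P; n (vdiff V (eval z) v) = 0\<rbrakk> \<Longrightarrow> converges (\<lambda>k. z) v"
  by (auto simp: converges_def)

lemma converges_elem: "v \<in> vecs V \<Longrightarrow> converges (\<lambda>k. elem v) v"
  by (simp add: converges_const eval_elem)

lemma converges_imp_cauchy:
  assumes s: "converges s v" and v: "v \<in> vecs V"
  shows "cauchy_seq P s"
  unfolding cauchy_seq_def
proof (intro conjI allI impI)
  fix e :: real assume "e > 0"
  moreover have "(\<lambda>k. n (vdiff V (eval (s k)) v)) \<longlonglongrightarrow> 0"
    using s by (simp add: converges_def)
  ultimately obtain N where N: "\<And>k. k \<ge> N \<Longrightarrow> n (vdiff V (eval (s k)) v) < e / 2"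
    using LIMSEQ_D[of "\<lambda>k. n (vdiff V (eval (s k)) v)" 0 "e / 2"] v converges_closed[OF s] by auto
  have "vnorm P (vdiff P (s i) (s j)) < e" if "i \<ge> N" "j \<ge> N" for i j
    using N[OF that(1)] N[OF that(2)] sn_diff_triangle[of "eval (s i)" v "eval (s j)"]
      sn_diff_commute[of v "eval (s j)"] v converges_closed[OF s]
    by (simp add: vnorm_vdiff_P)
  then show "\<exists>N. \<forall>i\<ge>N. \<forall>j\<ge>N. vnorm P (vdiff P (s i) (s j)) < e"
    by blast
qed (use s in \<open>auto simp: converges_def\<close>)

text \<open>Completion adds no points: \<open>V\<close> is already complete for \<open>n\<close>, so
  the evaluated sequence has a limit in \<open>V\<close>.\<close>

lemma cauchy_imp_converges:
  assumes "cauchy_seq P s"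
  obtains v where "v \<in> vecs V" "converges s v"
proof -
  have s: "s k \<in> vecs P" for k
    using assms by (auto simp: cauchy_seq_def)
  then have "\<exists>v\<in>vecs V. (\<lambda>k. n (vdiff V (eval (s k)) v)) \<longlonglongrightarrow> 0"
    using assms by (intro sn_complete) (auto simp: cauchy_seq_def vnorm_vdiff_P)
  then show ?thesis
    using that s by (auto simp: converges_def)
qed

lemma converges_unique:
  assumes "converges s v" "converges s w" "v \<in> vecs V" "w \<in> vecs V"
  shows "n (vdiff V v w) = 0"
proof -
  have s: "s k \<in> vecs P" for k
    using assms by (auto simp: converges_def)
  have "(\<lambda>k. n (vdiff V (eval (s k)) v) + n (vdiff V (eval (s k)) w)) \<longlonglongrightarrow> 0 + 0"
    using assms by (intro tendsto_add) (auto simp: converges_def)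
  moreover have "n (vdiff V v w) \<le> n (vdiff V (eval (s k)) v) + n (vdiff V (eval (s k)) w)" for k
    using sn_diff_triangle[of v "eval (s k)" w] sn_diff_commute[of v "eval (s k)"] s assms by simp
  ultimately have "n (vdiff V v w) \<le> 0 + 0"
    by (intro tendsto_lowerbound[where F = sequentially]) auto
  then show ?thesis
    using assms sn_antisym by simp
qed

lemma converges_limit_cong:
  assumes "converges s v" "v \<in> vecs V" "w \<in> vecs V" "n (vdiff V v w) = 0"
  shows "converges s w"
proof -
  have s: "s k \<in> vecs P" for k
    using assms by (auto simp: converges_def)
  have "n (vdiff V (eval (s k)) w) = n (vdiff V (eval (s k)) v)" for k
    using s assms sn_diff_triangle[of "eval (s k)" v w] sn_diff_triangle[of "eval (s k)" w v]
      sn_diff_commute[of v w] by simp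
  then show ?thesis
    using assms(1) by (simp add: converges_def)
qed

definition lim_class :: "'v \<Rightarrow> (nat \<Rightarrow> 'p) set" where
  "lim_class v = {s. converges s v}"

text \<open>By the triangle inequality, equivalence of sequences means having the same limit up to
  null vectors. A class of the completion can thus be named by a vector of \<open>V\<close>,
  whichever sequence represents it.\<close>

lemma compl_class_eq:
  assumes "converges s v" "v \<in> vecs V"
  shows "compl_class P s = lim_class v"
proof (rule set_eqI)
  fix s'
  have s: "s k \<in> vecs P" for k
    using assms by (auto simp: converges_def)
  show "s' \<in> compl_class P s \<longleftrightarrow> s' \<in> lim_class v"
  proof
    assume "s' \<in> compl_class P s"
    then have c: "cauchy_seq P s'" and l: "(\<lambda>k. vnorm P (vdiff P (s' k) (s k))) \<longlonglongrightarrow> 0"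
      by (auto simp: compl_class_def)
    have s': "s' k \<in> vecs P" for k
      using c by (auto simp: cauchy_seq_def)
    have "(\<lambda>k. n (vdiff V (eval (s' k)) (eval (s k))) + n (vdiff V (eval (s k)) v)) \<longlonglongrightarrow> 0 + 0"
      using l assms s s' by (intro tendsto_add) (auto simp: converges_def vnorm_vdiff_P)
    then have "(\<lambda>k. n (vdiff V (eval (s' k)) v)) \<longlonglongrightarrow> 0"
      by (rule metric_tendsto_imp_tendsto)
        (auto simp: s s' assms intro!: always_eventually sn_diff_triangle add_nonneg_nonneg)
    then show "s' \<in> lim_class v"
      using s' by (auto simp: lim_class_def converges_def)
  next
    assume "s' \<in> lim_class v"
    then have c: "converges s' v"
      by (simp add: lim_class_def)
    have s': "s' k \<in> vecs P" for k
      using c by (auto simp: converges_def)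
    have "(\<lambda>k. n (vdiff V (eval (s' k)) v) + n (vdiff V v (eval (s k)))) \<longlonglongrightarrow> 0 + 0"
      using c assms s by (intro tendsto_add) (auto simp: converges_def sn_diff_commute)
    then have "(\<lambda>k. n (vdiff V (eval (s' k)) (eval (s k)))) \<longlonglongrightarrow> 0"
      by (rule metric_tendsto_imp_tendsto)
        (auto simp: s s' assms intro!: always_eventually sn_diff_triangle add_nonneg_nonneg)
    then show "s' \<in> compl_class P s"
      using s s' converges_imp_cauchy[OF c assms(2)] by (simp add: compl_class_def vnorm_vdiff_P)
  qed
qed

lemma compl_class_elem: "v \<in> vecs V \<Longrightarrow> compl_class P (\<lambda>k. elem v) = lim_class v"
  by (rule compl_class_eq) (simp_all add: converges_elem)

lemma lim_class_eq_iff: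
  assumes "u \<in> vecs V" "v \<in> vecs V"
  shows "lim_class u = lim_class v \<longleftrightarrow> n (vdiff V u v) = 0"
proof
  assume "lim_class u = lim_class v"
  then have "converges (\<lambda>k. elem u) v"
    using converges_elem[OF assms(1)] by (auto simp: lim_class_def)
  then show "n (vdiff V u v) = 0"
    using converges_unique[OF converges_elem] assms by blast
next
  assume "n (vdiff V u v) = 0"
  then show "lim_class u = lim_class v"
    using assms converges_limit_cong[of _ u v] converges_limit_cong[of _ v u] sn_diff_commute[of u v]
    by (auto simp: lim_class_def)
qed

lemma rep_lim_class: "v \<in> vecs V \<Longrightarrow> converges (rep (lim_class v)) v"
  using rep_in[of "\<lambda>k. elem v" "lim_class v"] converges_elem by (simp add: lim_class_def)

lemma vecs_completion: "vecs (completion P) = lim_class ` vecs V"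
proof -
  have "compl_class P s \<in> lim_class ` vecs V" if "cauchy_seq P s" for s
    using that by (metis cauchy_imp_converges compl_class_eq image_eqI)
  moreover have "lim_class v \<in> compl_class P ` {s. cauchy_seq P s}" if "v \<in> vecs V" for v
    using that compl_class_elem converges_imp_cauchy[OF converges_elem] by blast
  ultimately show ?thesis
    by (auto simp: completion_def)
qed

lemma vzero_completion: "vzero (completion P) = lim_class (vzero V)"
  using compl_class_eq[OF converges_const, of "vzero P" "vzero V"]
  by (simp add: completion_def P_zero eval_zero)

text \<open>The sequences chosen by \<open>rep\<close> are arbitrary members of the two classes, so
  the sum is identified through its limit and not term by term.\<close>

lemma vadd_completion:
  assumes "u \<in> vecs V" "v \<in> vecs V"
  shows "vadd (completion P) (lim_class u) (lim_class v) = lim_class (vadd V u v)"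
proof -
  let ?r = "rep (lim_class u)" and ?s = "rep (lim_class v)"
  note c = rep_lim_class[OF assms(1)] rep_lim_class[OF assms(2)]
  note r = converges_closed[OF c(1)] converges_closed[OF c(2)]
  have "(\<lambda>k. n (vdiff V (eval (?r k)) u) + n (vdiff V (eval (?s k)) v)) \<longlonglongrightarrow> 0 + 0"
    using c by (intro tendsto_add) (auto simp: converges_def)
  then have "(\<lambda>k. n (vdiff V (eval (vadd P (?r k) (?s k))) (vadd V u v))) \<longlonglongrightarrow> 0"
    by (rule metric_tendsto_imp_tendsto)
      (auto simp: r assms eval_add add_diff_add intro!: always_eventually sn_add add_nonneg_nonneg)
  then have "converges (\<lambda>k. vadd P (?r k) (?s k)) (vadd V u v)"
    using r by (auto simp: converges_def P_add)
  then show ?thesis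
    using compl_class_eq assms by (simp add: completion_def)
qed

lemma vscale_completion:
  assumes "v \<in> vecs V"
  shows "vscale (completion P) c (lim_class v) = lim_class (vscale V c v)"
proof -
  let ?r = "rep (lim_class v)"
  note l = rep_lim_class[OF assms(1)]
  note r = converges_closed[OF l]
  have "(\<lambda>k. cmod c * n (vdiff V (eval (?r k)) v)) \<longlonglongrightarrow> cmod c * 0"
    using l by (intro tendsto_mult) (auto simp: converges_def)
  then have "converges (\<lambda>k. vscale P c (?r k)) (vscale V c v)"
    using r assms by (auto simp: converges_def P_scale eval_scale scale_diff sn_scale)
  then show ?thesis
    using compl_class_eq assms by (simp add: completion_def)
qed

lemma vnorm_completion:
  assumes "v \<in> vecs V"
  shows "vnorm (completion P) (lim_class v) = n v"
proof -
  let ?r = "rep (lim_class v)"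
  note l = rep_lim_class[OF assms(1)]
  note r = converges_closed[OF l]
  have "(\<lambda>k. vnorm P (?r k)) \<longlonglongrightarrow> n v"
  proof (rule metric_tendsto_imp_tendsto)
    show "(\<lambda>k. n (vdiff V (eval (?r k)) v)) \<longlonglongrightarrow> 0"
      using l by (simp add: converges_def)
    show "\<forall>\<^sub>F k in sequentially.
        dist (vnorm P (?r k)) (n v) \<le> dist (n (vdiff V (eval (?r k)) v)) 0"
      using r assms sn_abs_diff by (simp add: vnorm_P dist_real_def)
  qed
  then show ?thesis
    by (simp add: completion_def limI)
qed

lemma banach_completion: "complex_banach (completion P)"
  by (rule banach_image[where p = lim_class])
    (simp_all add: vecs_completion vzero_completion vadd_completion vscale_completion
      vnorm_completion lim_class_eq_iff)

end

section \<open>The action of continuous functions\<close>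

context cstar_category
begin

lemma comp_closed [simp]:
  "\<lbrakk>\<rho> \<in> objs C; \<sigma> \<in> objs C; \<tau> \<in> objs C; t' \<in> hom C \<rho> \<sigma>; t \<in> hom C \<sigma> \<tau>\<rbrakk>
    \<Longrightarrow> comp C \<rho> \<sigma> \<tau> t t' \<in> hom C \<rho> \<tau>"
  using comp_linear_right[of \<rho> \<sigma> \<tau> t] by (auto simp: linear_map_def)

lemma star_closed [simp]:
  "\<lbrakk>\<rho> \<in> objs C; \<sigma> \<in> objs C; t \<in> hom C \<rho> \<sigma>\<rbrakk> \<Longrightarrow> star C \<rho> \<sigma> t \<in> hom C \<sigma> \<rho>"
  using star_antilinear[of \<rho> \<sigma>] by (auto simp: antilinear_map_def)

lemma comp_add_right:
  "\<lbrakk>\<rho> \<in> objs C; \<sigma> \<in> objs C; \<tau> \<in> objs C; u \<in> hom C \<rho> \<sigma>; v \<in> hom C \<rho> \<sigma>; t \<in> hom C \<sigma> \<tau>\<rbrakk>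
    \<Longrightarrow> comp C \<rho> \<sigma> \<tau> t (vadd (arrs C \<rho> \<sigma>) u v) =
        vadd (arrs C \<rho> \<tau>) (comp C \<rho> \<sigma> \<tau> t u) (comp C \<rho> \<sigma> \<tau> t v)"
  using comp_linear_right[of \<rho> \<sigma> \<tau> t] by (auto simp: linear_map_def)

lemma comp_scale_right:
  "\<lbrakk>\<rho> \<in> objs C; \<sigma> \<in> objs C; \<tau> \<in> objs C; u \<in> hom C \<rho> \<sigma>; t \<in> hom C \<sigma> \<tau>\<rbrakk>
    \<Longrightarrow> comp C \<rho> \<sigma> \<tau> t (vscale (arrs C \<rho> \<sigma>) c u) = vscale (arrs C \<rho> \<tau>) c (comp C \<rho> \<sigma> \<tau> t u)"
  using comp_linear_right[of \<rho> \<sigma> \<tau> t] by (auto simp: linear_map_def)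

lemma comp_add_left:
  "\<lbrakk>\<rho> \<in> objs C; \<sigma> \<in> objs C; \<tau> \<in> objs C; u \<in> hom C \<sigma> \<tau>; v \<in> hom C \<sigma> \<tau>; t \<in> hom C \<rho> \<sigma>\<rbrakk>
    \<Longrightarrow> comp C \<rho> \<sigma> \<tau> (vadd (arrs C \<sigma> \<tau>) u v) t =
        vadd (arrs C \<rho> \<tau>) (comp C \<rho> \<sigma> \<tau> u t) (comp C \<rho> \<sigma> \<tau> v t)"
  using comp_linear_left[of \<rho> \<sigma> \<tau> t] by (auto simp: linear_map_def)

lemma comp_scale_left:
  "\<lbrakk>\<rho> \<in> objs C; \<sigma> \<in> objs C; \<tau> \<in> objs C; u \<in> hom C \<sigma> \<tau>; t \<in> hom C \<rho> \<sigma>\<rbrakk>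
    \<Longrightarrow> comp C \<rho> \<sigma> \<tau> (vscale (arrs C \<sigma> \<tau>) c u) t = vscale (arrs C \<rho> \<tau>) c (comp C \<rho> \<sigma> \<tau> u t)"
  using comp_linear_left[of \<rho> \<sigma> \<tau> t] by (auto simp: linear_map_def)

lemma star_add:
  "\<lbrakk>\<rho> \<in> objs C; \<sigma> \<in> objs C; u \<in> hom C \<rho> \<sigma>; v \<in> hom C \<rho> \<sigma>\<rbrakk>
    \<Longrightarrow> star C \<rho> \<sigma> (vadd (arrs C \<rho> \<sigma>) u v) = vadd (arrs C \<sigma> \<rho>) (star C \<rho> \<sigma> u) (star C \<rho> \<sigma> v)"
  using star_antilinear[of \<rho> \<sigma>] by (auto simp: antilinear_map_def)

lemma star_scale:
  "\<lbrakk>\<rho> \<in> objs C; \<sigma> \<in> objs C; u \<in> hom C \<rho> \<sigma>\<rbrakk>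
    \<Longrightarrow> star C \<rho> \<sigma> (vscale (arrs C \<rho> \<sigma>) c u) = vscale (arrs C \<sigma> \<rho>) (cnj c) (star C \<rho> \<sigma> u)"
  using star_antilinear[of \<rho> \<sigma>] by (auto simp: antilinear_map_def)

lemma scale_hom [simp]:
  "\<lbrakk>\<rho> \<in> objs C; \<sigma> \<in> objs C; u \<in> hom C \<rho> \<sigma>\<rbrakk> \<Longrightarrow> vscale (arrs C \<rho> \<sigma>) c u \<in> hom C \<rho> \<sigma>"
  by (rule complex_banach.scale_closed[OF banach])

lemma add_hom [simp]:
  "\<lbrakk>\<rho> \<in> objs C; \<sigma> \<in> objs C; u \<in> hom C \<rho> \<sigma>; v \<in> hom C \<rho> \<sigma>\<rbrakk>
    \<Longrightarrow> vadd (arrs C \<rho> \<sigma>) u v \<in> hom C \<rho> \<sigma>"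
  by (rule complex_banach.add_closed[OF banach])

lemma diff_hom [simp]:
  "\<lbrakk>\<rho> \<in> objs C; \<sigma> \<in> objs C; u \<in> hom C \<rho> \<sigma>; v \<in> hom C \<rho> \<sigma>\<rbrakk>
    \<Longrightarrow> vdiff (arrs C \<rho> \<sigma>) u v \<in> hom C \<rho> \<sigma>"
  by (simp add: vdiff_def)

lemma zero_hom [simp]: "\<lbrakk>\<rho> \<in> objs C; \<sigma> \<in> objs C\<rbrakk> \<Longrightarrow> vzero (arrs C \<rho> \<sigma>) \<in> hom C \<rho> \<sigma>"
  by (rule complex_banach.zero_closed[OF banach])

lemma norm_hom_nonneg [simp]:
  "\<lbrakk>\<rho> \<in> objs C; \<sigma> \<in> objs C; u \<in> hom C \<rho> \<sigma>\<rbrakk> \<Longrightarrow> 0 \<le> vnorm (arrs C \<rho> \<sigma>) u"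
  by (rule complex_banach.norm_nonneg[OF banach])

lemma comp_diff_right:
  "\<lbrakk>\<rho> \<in> objs C; \<sigma> \<in> objs C; \<tau> \<in> objs C; u \<in> hom C \<rho> \<sigma>; v \<in> hom C \<rho> \<sigma>; t \<in> hom C \<sigma> \<tau>\<rbrakk>
    \<Longrightarrow> comp C \<rho> \<sigma> \<tau> t (vdiff (arrs C \<rho> \<sigma>) u v) =
        vdiff (arrs C \<rho> \<tau>) (comp C \<rho> \<sigma> \<tau> t u) (comp C \<rho> \<sigma> \<tau> t v)"
  by (simp add: vdiff_def comp_add_right comp_scale_right)

lemma comp_diff_left:
  "\<lbrakk>\<rho> \<in> objs C; \<sigma> \<in> objs C; \<tau> \<in> objs C; u \<in> hom C \<sigma> \<tau>; v \<in> hom C \<sigma> \<tau>; t \<in> hom C \<rho> \<sigma>\<rbrakk>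
    \<Longrightarrow> comp C \<rho> \<sigma> \<tau> (vdiff (arrs C \<sigma> \<tau>) u v) t =
        vdiff (arrs C \<rho> \<tau>) (comp C \<rho> \<sigma> \<tau> u t) (comp C \<rho> \<sigma> \<tau> v t)"
  by (simp add: vdiff_def comp_add_left comp_scale_left)

lemma star_diff:
  "\<lbrakk>\<rho> \<in> objs C; \<sigma> \<in> objs C; u \<in> hom C \<rho> \<sigma>; v \<in> hom C \<rho> \<sigma>\<rbrakk>
    \<Longrightarrow> star C \<rho> \<sigma> (vdiff (arrs C \<rho> \<sigma>) u v) = vdiff (arrs C \<sigma> \<rho>) (star C \<rho> \<sigma> u) (star C \<rho> \<sigma> v)"
  by (simp add: vdiff_def star_add star_scale)

lemma diff_self_hom:
  "\<lbrakk>\<rho> \<in> objs C; \<sigma> \<in> objs C; u \<in> hom C \<rho> \<sigma>\<rbrakk>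
    \<Longrightarrow> vdiff (arrs C \<rho> \<sigma>) u u = vzero (arrs C \<rho> \<sigma>)"
  by (rule complex_banach.diff_self[OF banach])

lemma comp_zero_right:
  "\<lbrakk>\<rho> \<in> objs C; \<sigma> \<in> objs C; \<tau> \<in> objs C; t \<in> hom C \<sigma> \<tau>\<rbrakk>
    \<Longrightarrow> comp C \<rho> \<sigma> \<tau> t (vzero (arrs C \<rho> \<sigma>)) = vzero (arrs C \<rho> \<tau>)"
  using comp_diff_right[of \<rho> \<sigma> \<tau> "vzero (arrs C \<rho> \<sigma>)" "vzero (arrs C \<rho> \<sigma>)" t]
  by (simp add: diff_self_hom)

lemma comp_zero_left:
  "\<lbrakk>\<rho> \<in> objs C; \<sigma> \<in> objs C; \<tau> \<in> objs C; t \<in> hom C \<rho> \<sigma>\<rbrakk>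
    \<Longrightarrow> comp C \<rho> \<sigma> \<tau> (vzero (arrs C \<sigma> \<tau>)) t = vzero (arrs C \<rho> \<tau>)"
  using comp_diff_left[of \<rho> \<sigma> \<tau> "vzero (arrs C \<sigma> \<tau>)" "vzero (arrs C \<sigma> \<tau>)" t]
  by (simp add: diff_self_hom)

lemma star_zero:
  "\<lbrakk>\<rho> \<in> objs C; \<sigma> \<in> objs C\<rbrakk> \<Longrightarrow> star C \<rho> \<sigma> (vzero (arrs C \<rho> \<sigma>)) = vzero (arrs C \<sigma> \<rho>)"
  using star_diff[of \<rho> \<sigma> "vzero (arrs C \<rho> \<sigma>)" "vzero (arrs C \<rho> \<sigma>)"]
  by (simp add: diff_self_hom)

end

sublocale CX_category \<subseteq> cstar_category C
  by (rule category)

section \<open>The module structure over C(X)\<close>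

context CX_category
begin

text \<open>The restriction allows ordinary function expressions as arguments although
  \<open>cont_fun X\<close> consists of extensional functions. The left component suffices because
  the multipliers are central.\<close>

definition act :: "('x \<Rightarrow> complex) \<Rightarrow> 'o \<Rightarrow> 'o \<Rightarrow> 'a \<Rightarrow> 'a" where
  "act f = fst (\<phi> (restrict f (topspace X)))"

abbreviation ract :: "('x \<Rightarrow> real) \<Rightarrow> 'o \<Rightarrow> 'o \<Rightarrow> 'a \<Rightarrow> 'a" where
  "ract g \<equiv> act (\<lambda>x. complex_of_real (g x))"

lemma restrict_cont_fun:
  "continuous_map X euclidean f \<Longrightarrow> restrict f (topspace X) \<in> cont_fun X"
  by (auto simp: cont_fun_def intro: continuous_map_eq)

lemma act_cont_fun: "f \<in> cont_fun X \<Longrightarrow> act f = fst (\<phi> f)"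
  by (simp add: act_def cont_fun_def extensional_restrict)

lemma act_cong: "(\<And>x. x \<in> topspace X \<Longrightarrow> f x = g x) \<Longrightarrow> act f = act g"
  by (simp add: act_def cong: restrict_cong)

lemma
  assumes f: "continuous_map X euclidean f"
  shows snd_eq_act: "\<lbrakk>\<rho> \<in> objs C; \<sigma> \<in> objs C; t \<in> hom C \<rho> \<sigma>\<rbrakk>
      \<Longrightarrow> snd (\<phi> (restrict f (topspace X))) \<rho> \<sigma> t = act f \<rho> \<sigma> t"
    and act_linear: "\<lbrakk>\<rho> \<in> objs C; \<sigma> \<in> objs C\<rbrakk> \<Longrightarrow> linear_map (arrs C \<rho> \<sigma>) (arrs C \<rho> \<sigma>) (act f \<rho> \<sigma>)"
    and act_comp_left: "\<lbrakk>\<rho> \<in> objs C; \<sigma> \<in> objs C; \<tau> \<in> objs C; t' \<in> hom C \<rho> \<sigma>; t \<in> hom C \<sigma> \<tau>\<rbrakk>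
      \<Longrightarrow> act f \<rho> \<tau> (comp C \<rho> \<sigma> \<tau> t t') = comp C \<rho> \<sigma> \<tau> (act f \<sigma> \<tau> t) t'"
  using central[OF restrict_cont_fun[OF f]]
  unfolding central_multiplier_def is_multiplier_def left_multiplier_def bounded_family_def act_def
  by (simp, blast, blast)

text \<open>The right component has this property by definition, and centrality identifies it with
  the left one.\<close>

lemma act_comp_right:
  assumes f: "continuous_map X euclidean f"
    and o: "\<rho> \<in> objs C" "\<sigma> \<in> objs C" "\<tau> \<in> objs C" and t: "t' \<in> hom C \<rho> \<sigma>" "t \<in> hom C \<sigma> \<tau>"
  shows "act f \<rho> \<tau> (comp C \<rho> \<sigma> \<tau> t t') = comp C \<rho> \<sigma> \<tau> t (act f \<rho> \<sigma> t')"
proof -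
  have "snd (\<phi> (restrict f (topspace X))) \<rho> \<tau> (comp C \<rho> \<sigma> \<tau> t t') =
      comp C \<rho> \<sigma> \<tau> t (snd (\<phi> (restrict f (topspace X))) \<rho> \<sigma> t')"
    using central[OF restrict_cont_fun[OF f]] o t
    unfolding central_multiplier_def is_multiplier_def right_multiplier_def by blast
  then show ?thesis
    using o t by (simp add: snd_eq_act[OF f])
qed

lemma act_closed [simp]:
  "\<lbrakk>continuous_map X euclidean f; \<rho> \<in> objs C; \<sigma> \<in> objs C; t \<in> hom C \<rho> \<sigma>\<rbrakk>
    \<Longrightarrow> act f \<rho> \<sigma> t \<in> hom C \<rho> \<sigma>"
  using act_linear[of f \<rho> \<sigma>] by (auto simp: linear_map_def)

lemma act_vadd:
  "\<lbrakk>continuous_map X euclidean f; \<rho> \<in> objs C; \<sigma> \<in> objs C; u \<in> hom C \<rho> \<sigma>; v \<in> hom C \<rho> \<sigma>\<rbrakk>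
    \<Longrightarrow> act f \<rho> \<sigma> (vadd (arrs C \<rho> \<sigma>) u v) = vadd (arrs C \<rho> \<sigma>) (act f \<rho> \<sigma> u) (act f \<rho> \<sigma> v)"
  using act_linear[of f \<rho> \<sigma>] by (auto simp: linear_map_def)

lemma act_vscale:
  "\<lbrakk>continuous_map X euclidean f; \<rho> \<in> objs C; \<sigma> \<in> objs C; u \<in> hom C \<rho> \<sigma>\<rbrakk>
    \<Longrightarrow> act f \<rho> \<sigma> (vscale (arrs C \<rho> \<sigma>) c u) = vscale (arrs C \<rho> \<sigma>) c (act f \<rho> \<sigma> u)"
  using act_linear[of f \<rho> \<sigma>] by (auto simp: linear_map_def)

lemma act_one [simp]:
  "\<lbrakk>\<rho> \<in> objs C; \<sigma> \<in> objs C; t \<in> hom C \<rho> \<sigma>\<rbrakk> \<Longrightarrow> act (\<lambda>x. 1) \<rho> \<sigma> t = t"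
  using hom_one by (auto simp: act_def mult_eq_def mult_one_def)

lemma act_add:
  assumes "continuous_map X euclidean f" "continuous_map X euclidean g"
    and "\<rho> \<in> objs C" "\<sigma> \<in> objs C" "t \<in> hom C \<rho> \<sigma>"
  shows "act (\<lambda>x. f x + g x) \<rho> \<sigma> t = vadd (arrs C \<rho> \<sigma>) (act f \<rho> \<sigma> t) (act g \<rho> \<sigma> t)"
  using hom_add[OF assms(1,2)[THEN restrict_cont_fun]] assms(3-)
  by (simp add: act_def mult_eq_def mult_add_def cong: restrict_cong)

lemma act_mult:
  assumes "continuous_map X euclidean f" "continuous_map X euclidean g"
    and "\<rho> \<in> objs C" "\<sigma> \<in> objs C" "t \<in> hom C \<rho> \<sigma>"
  shows "act (\<lambda>x. f x * g x) \<rho> \<sigma> t = act f \<rho> \<sigma> (act g \<rho> \<sigma> t)"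
  using hom_mult[OF assms(1,2)[THEN restrict_cont_fun]] assms(3-)
  by (simp add: act_def mult_eq_def mult_prod_def cong: restrict_cong)

lemma act_scale:
  assumes "continuous_map X euclidean f"
    and "\<rho> \<in> objs C" "\<sigma> \<in> objs C" "t \<in> hom C \<rho> \<sigma>"
  shows "act (\<lambda>x. c * f x) \<rho> \<sigma> t = vscale (arrs C \<rho> \<sigma>) c (act f \<rho> \<sigma> t)"
  using hom_scale[OF assms(1)[THEN restrict_cont_fun], of c] assms(2-)
  by (simp add: act_def mult_eq_def mult_scale_def cong: restrict_cong)

lemma star_act:
  assumes f: "continuous_map X euclidean f"
    and "\<rho> \<in> objs C" "\<sigma> \<in> objs C" "t \<in> hom C \<rho> \<sigma>"
  shows "star C \<rho> \<sigma> (act f \<rho> \<sigma> t) = act (\<lambda>x. cnj (f x)) \<sigma> \<rho> (star C \<rho> \<sigma> t)"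
  using hom_star[OF restrict_cont_fun[OF f]] assms(2-) snd_eq_act[OF f]
  by (simp add: act_def mult_eq_def mult_star_def star_star cong: restrict_cong)

lemma continuous_map_cnj: "continuous_map X euclidean f \<Longrightarrow> continuous_map X euclidean (\<lambda>x. cnj (f x))"
  by (simp add: continuous_map_atin tendsto_cnj)

lemma continuous_map_cmult:
  fixes f g :: "'x \<Rightarrow> complex"
  assumes "continuous_map X euclidean f" "continuous_map X euclidean g"
  shows "continuous_map X euclidean (\<lambda>x. f x * g x)"
  using assms by (simp add: continuous_map_atin tendsto_mult)

lemma continuous_map_cof_real:
  "continuous_map X euclideanreal f \<Longrightarrow> continuous_map X euclidean (\<lambda>x. complex_of_real (f x))"
  by (simp add: continuous_map_atin tendsto_of_real)

section \<open>Contractivity of the action\<close>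

lemma star_act_comp_act:
  assumes f: "continuous_map X euclidean f"
    and o: "\<rho> \<in> objs C" "\<sigma> \<in> objs C" and t: "t \<in> hom C \<rho> \<sigma>"
  shows "comp C \<rho> \<sigma> \<rho> (star C \<rho> \<sigma> (act f \<rho> \<sigma> t)) (act f \<rho> \<sigma> t)
      = comp C \<rho> \<sigma> \<rho> (star C \<rho> \<sigma> t) (act (\<lambda>x. cnj (f x) * f x) \<rho> \<sigma> t)"
proof -
  note f' = continuous_map_cnj[OF f]
  have "comp C \<rho> \<sigma> \<rho> (star C \<rho> \<sigma> (act f \<rho> \<sigma> t)) (act f \<rho> \<sigma> t)
      = act (\<lambda>x. cnj (f x)) \<rho> \<rho> (comp C \<rho> \<sigma> \<rho> (star C \<rho> \<sigma> t) (act f \<rho> \<sigma> t))"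
    using f f' o t by (simp add: star_act act_comp_left)
  also have "\<dots> = comp C \<rho> \<sigma> \<rho> (star C \<rho> \<sigma> t) (act (\<lambda>x. cnj (f x)) \<rho> \<sigma> (act f \<rho> \<sigma> t))"
    using f f' o t by (intro act_comp_right) auto
  finally show ?thesis
    using f f' o t by (simp add: act_mult)
qed

text \<open>A unimodular function acts as a unitary: it cancels from the product of the adjoint of
  \<open>act f \<rho> \<sigma> t\<close> with \<open>act f \<rho> \<sigma> t\<close>, so the
  C*-identity gives equal norms.\<close>

lemma norm_act_unimodular:
  assumes f: "continuous_map X euclidean f" and mod: "\<And>x. x \<in> topspace X \<Longrightarrow> cmod (f x) = 1"
    and o: "\<rho> \<in> objs C" "\<sigma> \<in> objs C" and t: "t \<in> hom C \<rho> \<sigma>"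
  shows "vnorm (arrs C \<rho> \<sigma>) (act f \<rho> \<sigma> t) = vnorm (arrs C \<rho> \<sigma>) t"
proof -
  have one: "act (\<lambda>x. cnj (f x) * f x) = act (\<lambda>x. 1)"
    using mod by (intro act_cong) (simp add: complex_norm_square[symmetric] mult.commute)
  have "comp C \<rho> \<sigma> \<rho> (star C \<rho> \<sigma> (act f \<rho> \<sigma> t)) (act f \<rho> \<sigma> t) =
      comp C \<rho> \<sigma> \<rho> (star C \<rho> \<sigma> t) t"
    using f o t by (simp add: star_act_comp_act one)
  then have "(vnorm (arrs C \<rho> \<sigma>) (act f \<rho> \<sigma> t))\<^sup>2 = (vnorm (arrs C \<rho> \<sigma>) t)\<^sup>2"
    using cstar_identity f o t by (metis act_closed)
  then show ?thesis
    using f o t by simp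
qed

text \<open>A real function with values in \<open>[-1, 1]\<close> is the average of two unimodular ones.\<close>

lemma norm_ract_le:
  assumes h: "continuous_map X euclideanreal h" and le: "\<And>x. x \<in> topspace X \<Longrightarrow> \<bar>h x\<bar> \<le> 1"
    and o: "\<rho> \<in> objs C" "\<sigma> \<in> objs C" and t: "t \<in> hom C \<rho> \<sigma>"
  shows "vnorm (arrs C \<rho> \<sigma>) (ract h \<rho> \<sigma> t) \<le> vnorm (arrs C \<rho> \<sigma>) t"
proof -
  interpret complex_banach "arrs C \<rho> \<sigma>"
    using banach o by blast
  define u where "u = (\<lambda>x. Complex (h x) (sqrt (1 - (h x)\<^sup>2)))"
  have "continuous_map X euclideanreal (\<lambda>x. sqrt (1 - (h x)\<^sup>2))"
    using h by (intro continuous_intros) auto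
  with h have u: "continuous_map X euclidean u"
    by (simp add: u_def continuous_map_atin tendsto_Complex)
  note u' = continuous_map_cnj[OF u]
  have mod: "cmod (u x) = 1" if "x \<in> topspace X" for x
    using le[OF that] by (simp add: u_def cmod_def abs_square_le_1)
  have "(\<lambda>x. complex_of_real (h x)) = (\<lambda>x. (1/2) * (u x + cnj (u x)))"
    by (auto simp: u_def complex_eq_iff)
  then have "ract h \<rho> \<sigma> t = vscale (arrs C \<rho> \<sigma>) (1/2)
      (vadd (arrs C \<rho> \<sigma>) (act u \<rho> \<sigma> t) (act (\<lambda>x. cnj (u x)) \<rho> \<sigma> t))"
    using o t u u' act_scale[OF continuous_map_add[OF u u'], of \<rho> \<sigma> t "1/2"]
    by (simp add: act_add)
  then have "vnorm (arrs C \<rho> \<sigma>) (ract h \<rho> \<sigma> t) =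
      1/2 * vnorm (arrs C \<rho> \<sigma>) (vadd (arrs C \<rho> \<sigma>) (act u \<rho> \<sigma> t) (act (\<lambda>x. cnj (u x)) \<rho> \<sigma> t))"
    using o t u u' by (simp add: norm_scale)
  also have "\<dots> \<le> 1/2 * (vnorm (arrs C \<rho> \<sigma>) t + vnorm (arrs C \<rho> \<sigma>) t)"
    using norm_add[of "act u \<rho> \<sigma> t" "act (\<lambda>x. cnj (u x)) \<rho> \<sigma> t"] o t u u' mod
    by (simp add: norm_act_unimodular)
  finally show ?thesis
    by simp
qed

text \<open>The C*-identity reduces \<open>f\<close> to the real function
  \<open>(cmod (f x))\<^sup>2\<close>: the square of the norm in question is the norm of
  \<open>star C \<rho> \<sigma> t\<close> composed with the action of that function on
  \<open>t\<close>.\<close>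

lemma norm_act_le_one:
  assumes f: "continuous_map X euclidean f" and le: "\<And>x. x \<in> topspace X \<Longrightarrow> cmod (f x) \<le> 1"
    and o: "\<rho> \<in> objs C" "\<sigma> \<in> objs C" and t: "t \<in> hom C \<rho> \<sigma>"
  shows "vnorm (arrs C \<rho> \<sigma>) (act f \<rho> \<sigma> t) \<le> vnorm (arrs C \<rho> \<sigma>) t"
proof -
  have r: "continuous_map X euclideanreal (\<lambda>x. (cmod (f x))\<^sup>2)"
    using f by (intro continuous_intros) auto
  have eq: "(\<lambda>x. cnj (f x) * f x) = (\<lambda>x. complex_of_real ((cmod (f x))\<^sup>2))"
    by (simp only: complex_norm_square mult.commute)
  have "comp C \<rho> \<sigma> \<rho> (star C \<rho> \<sigma> (act f \<rho> \<sigma> t)) (act f \<rho> \<sigma> t)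
      = comp C \<rho> \<sigma> \<rho> (star C \<rho> \<sigma> t) (ract (\<lambda>x. (cmod (f x))\<^sup>2) \<rho> \<sigma> t)"
    using f o t by (simp only: star_act_comp_act eq)
  then have "(vnorm (arrs C \<rho> \<sigma>) (act f \<rho> \<sigma> t))\<^sup>2 =
      vnorm (arrs C \<rho> \<rho>) (comp C \<rho> \<sigma> \<rho> (star C \<rho> \<sigma> t) (ract (\<lambda>x. (cmod (f x))\<^sup>2) \<rho> \<sigma> t))"
    using cstar_identity f o t by (metis act_closed)
  also have "\<dots> \<le> vnorm (arrs C \<sigma> \<rho>) (star C \<rho> \<sigma> t) *
      vnorm (arrs C \<rho> \<sigma>) (ract (\<lambda>x. (cmod (f x))\<^sup>2) \<rho> \<sigma> t)"
    using o t r by (intro norm_comp) (simp_all add: continuous_map_cof_real del: of_real_power)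
  also have "\<dots> \<le> vnorm (arrs C \<rho> \<sigma>) t * vnorm (arrs C \<rho> \<sigma>) t"
    using o t r le
    by (intro mult_mono norm_ract_le)
      (simp_all add: norm_star power_le_one continuous_map_cof_real del: of_real_power)
  also have "\<dots> = (vnorm (arrs C \<rho> \<sigma>) t)\<^sup>2"
    by (rule power2_eq_square[symmetric])
  finally show ?thesis
    by (rule power2_le_imp_le) (use o t in simp)
qed

lemma norm_act_le:
  assumes f: "continuous_map X euclidean f" and le: "\<And>x. x \<in> topspace X \<Longrightarrow> cmod (f x) \<le> e"
    and "e > 0" and o: "\<rho> \<in> objs C" "\<sigma> \<in> objs C" and t: "t \<in> hom C \<rho> \<sigma>"
  shows "vnorm (arrs C \<rho> \<sigma>) (act f \<rho> \<sigma> t) \<le> e * vnorm (arrs C \<rho> \<sigma>) t"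
proof -
  interpret complex_banach "arrs C \<rho> \<sigma>"
    using banach o by blast
  define g where "g = (\<lambda>x. complex_of_real (1/e) * f x)"
  have g: "continuous_map X euclidean g"
    unfolding g_def using f by (intro continuous_map_cmult) auto
  have fg: "f = (\<lambda>x. complex_of_real e * g x)"
    using \<open>e > 0\<close> by (simp add: g_def fun_eq_iff)
  have "vnorm (arrs C \<rho> \<sigma>) (act f \<rho> \<sigma> t) = e * vnorm (arrs C \<rho> \<sigma>) (act g \<rho> \<sigma> t)"
    using g o t \<open>e > 0\<close> by (subst fg) (simp add: act_scale norm_scale)
  also have "\<dots> \<le> e * vnorm (arrs C \<rho> \<sigma>) t"
    using g o t \<open>e > 0\<close> le
    by (intro mult_left_mono norm_act_le_one) (auto simp: g_def norm_mult norm_divide divide_le_eq)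
  finally show ?thesis .
qed

lemma norm_ract_sum_le:
  assumes "finite I" and h: "\<And>i. i \<in> I \<Longrightarrow> continuous_map X euclideanreal (h i)"
    and o: "\<rho> \<in> objs C" "\<sigma> \<in> objs C" and t: "t \<in> hom C \<rho> \<sigma>"
  shows "vnorm (arrs C \<rho> \<sigma>) (ract (\<lambda>x. \<Sum>i\<in>I. h i x) \<rho> \<sigma> t)
    \<le> (\<Sum>i\<in>I. vnorm (arrs C \<rho> \<sigma>) (ract (h i) \<rho> \<sigma> t))"
proof -
  interpret complex_banach "arrs C \<rho> \<sigma>"
    using banach o by blast
  show ?thesis
    using \<open>finite I\<close> h
  proof (induction I rule: finite_induct)
    case empty
    then show ?case
      using act_scale[of "\<lambda>x. 1" \<rho> \<sigma> t 0] o t by simp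
  next
    case (insert i I)
    have c: "continuous_map X euclideanreal (h i)"
        "continuous_map X euclideanreal (\<lambda>x. \<Sum>i\<in>I. h i x)"
      using insert by (auto intro!: continuous_map_sum)
    note c' = c[THEN continuous_map_cof_real]
    have "ract (\<lambda>x. \<Sum>i\<in>insert i I. h i x) \<rho> \<sigma> t =
        vadd (arrs C \<rho> \<sigma>) (ract (h i) \<rho> \<sigma> t) (ract (\<lambda>x. \<Sum>i\<in>I. h i x) \<rho> \<sigma> t)"
      using insert o t act_add[OF c'] by simp
    then show ?case
      using insert o t c' norm_add[of "ract (h i) \<rho> \<sigma> t" "ract (\<lambda>x. \<Sum>i\<in>I. h i x) \<rho> \<sigma> t"]
      by simp
  qed
qed

end

section \<open>Localization of the norm\<close>

text \<open>If \<open>a > c > 0\<close>, the powers of \<open>a / c\<close> outgrow the constant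
  \<open>K\<close>, which does not depend on \<open>k\<close>. The exponents are those at which
  repeated squaring and the C*-identity give the norms of powers.\<close>

lemma le_of_power_le:
  fixes a c K :: real
  assumes "0 \<le> a" "0 \<le> c" and le: "\<And>k. a ^ (2 ^ Suc k) \<le> K * c ^ (2 ^ Suc k)"
  shows "a \<le> c"
proof (rule ccontr)
  assume "\<not> a \<le> c"
  show False
  proof (cases "c = 0")
    case True
    then show ?thesis
      using le[of 0] \<open>\<not> a \<le> c\<close> by simp
  next
    case False
    then have q: "a / c > 1"
      using \<open>\<not> a \<le> c\<close> \<open>0 \<le> c\<close> by simp
    then obtain k where k: "K < (a / c) ^ k"
      using real_arch_pow by blast
    also have "\<dots> \<le> (a / c) ^ (2 ^ Suc k)"
    proof (rule power_increasing)
      show "k \<le> 2 ^ Suc k"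
        using less_exp[of "Suc k"] by linarith
    qed (use q in simp)
    also have "\<dots> \<le> K"
      using le[of k] False \<open>0 \<le> c\<close> by (simp add: power_divide divide_le_eq del: power_Suc)
    finally show False
      by simp
  qed
qed

section \<open>Bump functions\<close>

locale compact_CX_category = CX_category X C \<phi>
  for X :: "'x topology" and C :: "('o, 'a) ccat" and \<phi> +
  assumes compact: "compact_space X" and hausdorff: "Hausdorff_space X"
begin

text \<open>Requiring the value 1 on a neighbourhood, not only at \<open>x\<close>, makes a bump at
  \<open>x\<close> a bump at all nearby points, which is what semicontinuity rests on. Values in
  [0,1] make truncation contractive and square roots available.\<close>

definition bumps :: "'x \<Rightarrow> ('x \<Rightarrow> real) set" where
  "bumps x = {g. continuous_map X euclideanreal g \<and> (\<forall>y\<in>topspace X. 0 \<le> g y \<and> g y \<le> 1) \<and>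
     (\<exists>U. openin X U \<and> x \<in> U \<and> (\<forall>y\<in>U. g y = 1))}"

lemma bump_cont: "g \<in> bumps x \<Longrightarrow> continuous_map X euclideanreal g"
  and bump_ccont: "g \<in> bumps x \<Longrightarrow> continuous_map X euclidean (\<lambda>y. complex_of_real (g y))"
  and bump_range: "\<lbrakk>g \<in> bumps x; y \<in> topspace X\<rbrakk> \<Longrightarrow> 0 \<le> g y \<and> g y \<le> 1"
  and bump_at: "g \<in> bumps x \<Longrightarrow> g x = 1"
  by (auto simp: bumps_def continuous_map_cof_real)

lemma bump_one: "x \<in> topspace X \<Longrightarrow> (\<lambda>y. 1) \<in> bumps x"
  by (auto simp: bumps_def)

lemma bump_mult:
  assumes "g \<in> bumps x" "h \<in> bumps x"
  shows "(\<lambda>y. g y * h y) \<in> bumps x"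
proof -
  obtain U W where "openin X U" "x \<in> U" "\<forall>y\<in>U. g y = 1" "openin X W" "x \<in> W" "\<forall>y\<in>W. h y = 1"
    using assms by (auto simp: bumps_def)
  then have "openin X (U \<inter> W) \<and> x \<in> U \<inter> W \<and> (\<forall>y\<in>U \<inter> W. g y * h y = 1)"
    by auto
  then show ?thesis
    using assms by (auto simp: bumps_def mult_le_one continuous_map_real_mult simp del: Int_iff)
qed

lemma bump_sqrt: "g \<in> bumps x \<Longrightarrow> (\<lambda>y. sqrt (g y)) \<in> bumps x"
  by (fastforce simp: bumps_def intro: continuous_map_sqrt)

lemma bump_supported:
  assumes U: "openin X U" and x: "x \<in> U"
  obtains g where "g \<in> bumps x" "\<And>y. y \<in> topspace X - U \<Longrightarrow> g y = 0"
proof -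
  have xX: "x \<in> topspace X"
    using U x openin_subset by blast
  have "normal_space X"
    using compact hausdorff compact_Hausdorff_or_regular_imp_normal_space by blast
  moreover have "closedin X (topspace X - U)" "closedin X {x}"
    using U hausdorff xX by (auto simp: closedin_Hausdorff_sing_eq)
  moreover have "disjnt (topspace X - U) {x}"
    using x by (simp add: disjnt_def)
  ultimately obtain f where f: "continuous_map X (top_of_set {0..1::real}) f"
      "f ` (topspace X - U) \<subseteq> {0}" "f ` {x} \<subseteq> {1}"
    using Urysohn_lemma[of X "topspace X - U" "{x}" 0 1] by auto
  have fc: "continuous_map X euclideanreal f" and fr: "\<And>y. y \<in> topspace X \<Longrightarrow> 0 \<le> f y \<and> f y \<le> 1"
    using f(1) by (auto simp: continuous_map_in_subtopology image_subset_iff)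
  \<comment> \<open>Urysohn's function is known to be 1 only at \<open>x\<close> itself; doubling
    and capping makes it 1 on the open set where it exceeds 1/2.\<close>
  define g where "g = (\<lambda>y. min 1 (2 * f y))"
  have "openin X {y \<in> topspace X. f y \<in> {1/2<..}}"
    by (rule openin_continuous_map_preimage[OF fc]) auto
  moreover have "x \<in> {y \<in> topspace X. f y \<in> {1/2<..}}"
    using f(3) xX by auto
  moreover have "\<forall>y \<in> {y \<in> topspace X. f y \<in> {1/2<..}}. g y = 1"
    by (auto simp: g_def)
  moreover have "continuous_map X euclideanreal g"
    unfolding g_def using fc by (intro continuous_intros) auto
  ultimately have "g \<in> bumps x"
    using fr unfolding bumps_def by (auto simp: g_def)
  moreover have "g y = 0" if "y \<in> topspace X - U" for y
    using f(2) that by (force simp: g_def)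
  ultimately show ?thesis
    using that by blast
qed

lemma norm_bump_le:
  "\<lbrakk>g \<in> bumps x; \<rho> \<in> objs C; \<sigma> \<in> objs C; t \<in> hom C \<rho> \<sigma>\<rbrakk>
    \<Longrightarrow> vnorm (arrs C \<rho> \<sigma>) (ract g \<rho> \<sigma> t) \<le> vnorm (arrs C \<rho> \<sigma>) t"
  by (rule norm_ract_le) (auto dest: bump_range intro: bump_cont)

section \<open>The local seminorm at a point\<close>

definition lnorm :: "'x \<Rightarrow> 'o \<Rightarrow> 'o \<Rightarrow> 'a \<Rightarrow> real" where
  "lnorm x \<rho> \<sigma> t = Inf ((\<lambda>g. vnorm (arrs C \<rho> \<sigma>) (ract g \<rho> \<sigma> t)) ` bumps x)"

context
  fixes \<rho> \<sigma> x
  assumes o: "\<rho> \<in> objs C" "\<sigma> \<in> objs C" and x: "x \<in> topspace X"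
begin

lemma lnorm_le:
  assumes "t \<in> hom C \<rho> \<sigma>" "g \<in> bumps x"
  shows "lnorm x \<rho> \<sigma> t \<le> vnorm (arrs C \<rho> \<sigma>) (ract g \<rho> \<sigma> t)"
  unfolding lnorm_def
  by (rule cInf_lower)
    (use assms o in \<open>auto intro!: bdd_belowI[where m = 0] simp: bump_ccont\<close>)

lemma lnorm_lessE:
  assumes "lnorm x \<rho> \<sigma> t < e"
  obtains g where "g \<in> bumps x" "vnorm (arrs C \<rho> \<sigma>) (ract g \<rho> \<sigma> t) < e"
  using cInf_lessD[OF _ assms[unfolded lnorm_def]] bump_one[OF x] by auto

lemma lnorm_greatest:
  assumes "\<And>g. g \<in> bumps x \<Longrightarrow> r \<le> vnorm (arrs C \<rho> \<sigma>) (ract g \<rho> \<sigma> t)"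
  shows "r \<le> lnorm x \<rho> \<sigma> t"
  unfolding lnorm_def by (rule cInf_greatest) (use assms bump_one[OF x] in auto)

lemma lnorm_nonneg: "t \<in> hom C \<rho> \<sigma> \<Longrightarrow> 0 \<le> lnorm x \<rho> \<sigma> t"
  by (rule lnorm_greatest) (simp add: o bump_ccont)

lemma lnorm_le_norm: "t \<in> hom C \<rho> \<sigma> \<Longrightarrow> lnorm x \<rho> \<sigma> t \<le> vnorm (arrs C \<rho> \<sigma>) t"
  using lnorm_le[OF _ bump_one[OF x]] o by simp

text \<open>A bump supported where \<open>f\<close> has modulus less than \<open>d\<close> makes the
  product with \<open>f\<close> bounded by \<open>d\<close> on all of \<open>X\<close>, and then
  \<open>norm_act_le\<close> applies.\<close>

lemma lnorm_act_vanishing: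
  assumes f: "continuous_map X euclidean f" "f x = 0" and t: "t \<in> hom C \<rho> \<sigma>"
  shows "lnorm x \<rho> \<sigma> (act f \<rho> \<sigma> t) = 0"
proof (rule antisym[OF field_le_epsilon lnorm_nonneg])
  fix e :: real assume e: "e > 0"
  \<comment> \<open>Adding 1 keeps the denominator positive when \<open>t\<close> is zero.\<close>
  define d where "d = e / (vnorm (arrs C \<rho> \<sigma>) t + 1)"
  have n: "0 \<le> vnorm (arrs C \<rho> \<sigma>) t"
    using o t by simp
  then have d: "d > 0" "d * vnorm (arrs C \<rho> \<sigma>) t \<le> e"
    using e by (auto simp: d_def field_simps)
  have "openin X {y \<in> topspace X. f y \<in> ball 0 d}"
    by (rule openin_continuous_map_preimage[OF f(1)]) auto
  moreover have "x \<in> {y \<in> topspace X. f y \<in> ball 0 d}"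
    using f d x by auto
  ultimately obtain g where g: "g \<in> bumps x"
      "\<And>y. y \<in> topspace X - {y \<in> topspace X. f y \<in> ball 0 d} \<Longrightarrow> g y = 0"
    by (rule bump_supported) blast
  have "cmod (complex_of_real (g y) * f y) \<le> d" if y: "y \<in> topspace X" for y
  proof (cases "f y \<in> ball 0 d")
    case True
    then show ?thesis
      using bump_range[OF g(1) y] mult_mono[of "g y" 1 "cmod (f y)" d] d
      by (simp add: norm_mult)
  next
    case False
    then show ?thesis
      using g(2)[of y] y d by simp
  qed
  then have "vnorm (arrs C \<rho> \<sigma>) (act (\<lambda>y. complex_of_real (g y) * f y) \<rho> \<sigma> t) \<le>
      d * vnorm (arrs C \<rho> \<sigma>) t"
    using d f g o t by (intro norm_act_le continuous_map_cmult bump_ccont) auto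
  then show "lnorm x \<rho> \<sigma> (act f \<rho> \<sigma> t) \<le> 0 + e"
    using lnorm_le[of "act f \<rho> \<sigma> t" g] f g o t d by (simp add: act_mult bump_ccont)
qed (use f o t in auto)

lemma diff_act:
  assumes f: "continuous_map X euclidean f" and t: "t \<in> hom C \<rho> \<sigma>"
  shows "vdiff (arrs C \<rho> \<sigma>) t (act f \<rho> \<sigma> t) = act (\<lambda>y. 1 + (- 1) * f y) \<rho> \<sigma> t"
proof -
  have "continuous_map X euclidean (\<lambda>y. (- 1) * f y)"
    using f by (intro continuous_map_cmult) auto
  then show ?thesis
    using act_add[of "\<lambda>y. 1" "\<lambda>y. (- 1) * f y" \<rho> \<sigma> t] act_scale[OF f o t, of "- 1"] o t
    by (simp add: vdiff_def)
qed

text \<open>The difference is the action of \<open>1 - g\<close>, which vanishes at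
  \<open>x\<close>. Truncation thus changes an arrow only by a null arrow.\<close>

lemma lnorm_diff_bump:
  assumes "g \<in> bumps x" "t \<in> hom C \<rho> \<sigma>"
  shows "lnorm x \<rho> \<sigma> (vdiff (arrs C \<rho> \<sigma>) t (ract g \<rho> \<sigma> t)) = 0"
  using assms
  by (subst diff_act)
    (auto intro!: lnorm_act_vanishing continuous_map_diff
      simp: bump_ccont bump_at)

text \<open>Nearly optimal bumps for the two summands are replaced by their product, which is again
  a bump and does at least as well for each of them.\<close>

lemma lnorm_add:
  assumes "u \<in> hom C \<rho> \<sigma>" "v \<in> hom C \<rho> \<sigma>"
  shows "lnorm x \<rho> \<sigma> (vadd (arrs C \<rho> \<sigma>) u v) \<le> lnorm x \<rho> \<sigma> u + lnorm x \<rho> \<sigma> v"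
proof (rule field_le_epsilon)
  interpret complex_banach "arrs C \<rho> \<sigma>"
    by (rule banach[OF o])
  fix e :: real assume e: "e > 0"
  obtain g where g: "g \<in> bumps x" "vnorm (arrs C \<rho> \<sigma>) (ract g \<rho> \<sigma> u) < lnorm x \<rho> \<sigma> u + e / 2"
    by (rule lnorm_lessE[of u "lnorm x \<rho> \<sigma> u + e / 2"]) (use e in auto)
  obtain h where h: "h \<in> bumps x" "vnorm (arrs C \<rho> \<sigma>) (ract h \<rho> \<sigma> v) < lnorm x \<rho> \<sigma> v + e / 2"
    by (rule lnorm_lessE[of v "lnorm x \<rho> \<sigma> v + e / 2"]) (use e in auto)
  note c = bump_ccont[OF g(1)] bump_ccont[OF h(1)]
  \<comment> \<open>\<open>act_mult\<close> applies the second factor first, so \<open>u\<close>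
    needs the order with \<open>g\<close> inside and \<open>v\<close> the order with
    \<open>h\<close> inside; the outer factor is then dropped by contractivity.\<close>
  have gh: "(\<lambda>y. g y * h y) \<in> bumps x" "(\<lambda>y. h y * g y) \<in> bumps x"
    using g h by (auto intro: bump_mult)
  have "lnorm x \<rho> \<sigma> (vadd (arrs C \<rho> \<sigma>) u v) \<le>
      vnorm (arrs C \<rho> \<sigma>) (ract (\<lambda>y. g y * h y) \<rho> \<sigma> (vadd (arrs C \<rho> \<sigma>) u v))"
    using assms gh by (intro lnorm_le) auto
  also have "\<dots> = vnorm (arrs C \<rho> \<sigma>) (vadd (arrs C \<rho> \<sigma>)
      (ract (\<lambda>y. h y * g y) \<rho> \<sigma> u) (ract (\<lambda>y. g y * h y) \<rho> \<sigma> v))"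
    using assms o bump_ccont[OF gh(1)] by (simp add: act_vadd mult.commute)
  also have "\<dots> \<le> vnorm (arrs C \<rho> \<sigma>) (ract (\<lambda>y. h y * g y) \<rho> \<sigma> u) +
      vnorm (arrs C \<rho> \<sigma>) (ract (\<lambda>y. g y * h y) \<rho> \<sigma> v)"
    using assms o bump_ccont[OF gh(1)] bump_ccont[OF gh(2)] by (intro norm_add) auto
  also have "\<dots> \<le> vnorm (arrs C \<rho> \<sigma>) (ract g \<rho> \<sigma> u) + vnorm (arrs C \<rho> \<sigma>) (ract h \<rho> \<sigma> v)"
    using assms o c norm_bump_le[OF g(1) o, of "ract h \<rho> \<sigma> v"]
      norm_bump_le[OF h(1) o, of "ract g \<rho> \<sigma> u"] by (simp add: act_mult)
  finally show "lnorm x \<rho> \<sigma> (vadd (arrs C \<rho> \<sigma>) u v) \<le> lnorm x \<rho> \<sigma> u + lnorm x \<rho> \<sigma> v + e"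
    using g h by simp
qed

text \<open>Only one inequality is proved from the definition; for nonzero \<open>c\<close> the
  other is the same inequality for the scalar \<open>1 / c\<close> and the vector
  \<open>c v\<close>.\<close>

lemma lnorm_scale:
  assumes "v \<in> hom C \<rho> \<sigma>"
  shows "lnorm x \<rho> \<sigma> (vscale (arrs C \<rho> \<sigma>) c v) = cmod c * lnorm x \<rho> \<sigma> v"
proof -
  interpret complex_banach "arrs C \<rho> \<sigma>"
    by (rule banach[OF o])
  have ge: "cmod c * lnorm x \<rho> \<sigma> v \<le> lnorm x \<rho> \<sigma> (vscale (arrs C \<rho> \<sigma>) c v)"
    if "v \<in> hom C \<rho> \<sigma>" for c v
    using that o
    by (intro lnorm_greatest)
      (auto simp: act_vscale norm_scale bump_ccont intro!: mult_left_mono lnorm_le)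
  show ?thesis
  proof (cases "c = 0")
    case True
    then show ?thesis
      using assms lnorm_le_norm[of "vzero (arrs C \<rho> \<sigma>)"] lnorm_nonneg[of "vzero (arrs C \<rho> \<sigma>)"]
      by simp
  next
    case False
    then show ?thesis
      using ge[OF assms, of c] ge[of "vscale (arrs C \<rho> \<sigma>) c v" "1 / c"] assms
      by (simp add: norm_divide field_simps)
  qed
qed

text \<open>The witness is a truncation of \<open>v\<close>: small in norm by the choice of the
  bump, and congruent to \<open>v\<close> by \<open>lnorm_diff_bump\<close>.\<close>

lemma lnorm_lift:
  assumes "v \<in> hom C \<rho> \<sigma>" "lnorm x \<rho> \<sigma> v < e"
  shows "\<exists>w\<in>hom C \<rho> \<sigma>. vnorm (arrs C \<rho> \<sigma>) w < e \<and> lnorm x \<rho> \<sigma> (vdiff (arrs C \<rho> \<sigma>) v w) = 0"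
proof -
  obtain g where g: "g \<in> bumps x" "vnorm (arrs C \<rho> \<sigma>) (ract g \<rho> \<sigma> v) < e"
    using assms lnorm_lessE by blast
  then show ?thesis
    using lnorm_diff_bump[OF g(1) assms(1)] o assms by (auto simp: bump_ccont)
qed

lemma quotient_seminorm_lnorm: "quotient_seminorm (arrs C \<rho> \<sigma>) (lnorm x \<rho> \<sigma>)"
  by (intro quotient_seminorm.intro quotient_seminorm_axioms.intro banach o
      lnorm_nonneg lnorm_add lnorm_scale lnorm_le_norm lnorm_lift)

text \<open>Takes the infimum inside a product. The case \<open>b = 0\<close> is separate because
  the argument divides by \<open>b\<close>.\<close>

lemma le_lnorm_mult:
  assumes "\<And>g. g \<in> bumps x \<Longrightarrow> r \<le> vnorm (arrs C \<rho> \<sigma>) (ract g \<rho> \<sigma> t) * b" and "0 \<le> b"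
  shows "r \<le> lnorm x \<rho> \<sigma> t * b"
proof (cases "b = 0")
  case True
  then show ?thesis
    using assms(1)[OF bump_one[OF x]] by simp
next
  case False
  with \<open>0 \<le> b\<close> have "b > 0"
    by simp
  then have "r / b \<le> lnorm x \<rho> \<sigma> t"
    using assms(1) by (intro lnorm_greatest) (simp add: divide_le_eq)
  then show ?thesis
    using \<open>b > 0\<close> by (simp add: divide_le_eq)
qed

end

section \<open>Compatibility with composition and involution\<close>

lemma ract_comp:
  assumes o: "\<rho> \<in> objs C" "\<sigma> \<in> objs C" "\<tau> \<in> objs C" and t: "t' \<in> hom C \<rho> \<sigma>" "t \<in> hom C \<sigma> \<tau>"
    and c: "continuous_map X euclideanreal g" "continuous_map X euclideanreal h"
  shows "ract (\<lambda>y. g y * h y) \<rho> \<tau> (comp C \<rho> \<sigma> \<tau> t t') =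
    comp C \<rho> \<sigma> \<tau> (ract g \<sigma> \<tau> t) (ract h \<rho> \<sigma> t')"
proof -
  note c' = c[THEN continuous_map_cof_real]
  have "ract (\<lambda>y. g y * h y) \<rho> \<tau> (comp C \<rho> \<sigma> \<tau> t t') =
      ract g \<rho> \<tau> (ract h \<rho> \<tau> (comp C \<rho> \<sigma> \<tau> t t'))"
    using o t c' by (simp add: act_mult)
  also have "\<dots> = ract g \<rho> \<tau> (comp C \<rho> \<sigma> \<tau> t (ract h \<rho> \<sigma> t'))"
    using o t c' by (simp add: act_comp_right)
  also have "\<dots> = comp C \<rho> \<sigma> \<tau> (ract g \<sigma> \<tau> t) (ract h \<rho> \<sigma> t')"
    using o t c' by (simp add: act_comp_left)
  finally show ?thesis .
qed

lemma star_ract: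
  "\<lbrakk>continuous_map X euclideanreal g; \<rho> \<in> objs C; \<sigma> \<in> objs C; t \<in> hom C \<rho> \<sigma>\<rbrakk>
    \<Longrightarrow> star C \<rho> \<sigma> (ract g \<rho> \<sigma> t) = ract g \<sigma> \<rho> (star C \<rho> \<sigma> t)"
  by (simp add: star_act continuous_map_cof_real)

lemma norm_ract_square:
  assumes "continuous_map X euclideanreal g" "\<rho> \<in> objs C" "\<sigma> \<in> objs C" "t \<in> hom C \<rho> \<sigma>"
  shows "vnorm (arrs C \<rho> \<rho>) (ract (\<lambda>y. g y * g y) \<rho> \<rho> (comp C \<rho> \<sigma> \<rho> (star C \<rho> \<sigma> t) t)) =
    (vnorm (arrs C \<rho> \<sigma>) (ract g \<rho> \<sigma> t))\<^sup>2"
  using assms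
  by (simp add: ract_comp cstar_identity continuous_map_cof_real flip: star_ract del: of_real_mult)

text \<open>A product of bumps splits over a composite, one factor on each arrow. The two bumps are
  independent, so the infima can be taken one after the other.\<close>

lemma lnorm_comp:
  assumes o: "\<rho> \<in> objs C" "\<sigma> \<in> objs C" "\<tau> \<in> objs C" and x: "x \<in> topspace X"
    and t: "t' \<in> hom C \<rho> \<sigma>" "t \<in> hom C \<sigma> \<tau>"
  shows "lnorm x \<rho> \<tau> (comp C \<rho> \<sigma> \<tau> t t') \<le> lnorm x \<sigma> \<tau> t * lnorm x \<rho> \<sigma> t'"
proof -
  have "lnorm x \<rho> \<tau> (comp C \<rho> \<sigma> \<tau> t t') \<le>
      vnorm (arrs C \<sigma> \<tau>) (ract g \<sigma> \<tau> t) * vnorm (arrs C \<rho> \<sigma>) (ract h \<rho> \<sigma> t')"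
    if g: "g \<in> bumps x" and h: "h \<in> bumps x" for g h
  proof -
    have "lnorm x \<rho> \<tau> (comp C \<rho> \<sigma> \<tau> t t') \<le>
        vnorm (arrs C \<rho> \<tau>) (comp C \<rho> \<sigma> \<tau> (ract g \<sigma> \<tau> t) (ract h \<rho> \<sigma> t'))"
      using lnorm_le[OF o(1,3) x _ bump_mult[OF g h], of "comp C \<rho> \<sigma> \<tau> t t'"] o t
        ract_comp[OF o t bump_cont[OF g] bump_cont[OF h]]
      by simp
    also have "\<dots> \<le> vnorm (arrs C \<sigma> \<tau>) (ract g \<sigma> \<tau> t) * vnorm (arrs C \<rho> \<sigma>) (ract h \<rho> \<sigma> t')"
      using o t bump_ccont[OF g] bump_ccont[OF h] by (intro norm_comp) auto
    finally show ?thesis .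
  qed
  then have "lnorm x \<rho> \<tau> (comp C \<rho> \<sigma> \<tau> t t') \<le>
      lnorm x \<sigma> \<tau> t * vnorm (arrs C \<rho> \<sigma>) (ract h \<rho> \<sigma> t')" if h: "h \<in> bumps x" for h
    using h o x t bump_ccont[OF h] by (intro le_lnorm_mult) auto
  then have "lnorm x \<rho> \<tau> (comp C \<rho> \<sigma> \<tau> t t') \<le> lnorm x \<rho> \<sigma> t' * lnorm x \<sigma> \<tau> t"
    using o x t by (intro le_lnorm_mult lnorm_nonneg) (auto simp: mult.commute)
  then show ?thesis
    by (simp add: mult.commute)
qed

lemma lnorm_star:
  assumes "\<rho> \<in> objs C" "\<sigma> \<in> objs C" "t \<in> hom C \<rho> \<sigma>"
  shows "lnorm x \<sigma> \<rho> (star C \<rho> \<sigma> t) = lnorm x \<rho> \<sigma> t"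
proof -
  have "vnorm (arrs C \<sigma> \<rho>) (ract g \<sigma> \<rho> (star C \<rho> \<sigma> t)) = vnorm (arrs C \<rho> \<sigma>) (ract g \<rho> \<sigma> t)"
    if g: "g \<in> bumps x" for g
    using assms bump_ccont[OF g] by (simp add: norm_star flip: star_ract[OF bump_cont[OF g]])
  then show ?thesis
    by (simp add: lnorm_def cong: image_cong)
qed

text \<open>One inequality is submultiplicativity together with \<open>lnorm_star\<close>. For the
  other, truncating the product by \<open>g\<close> amounts to truncating \<open>t\<close> by the
  square root of \<open>g\<close>, which is again a bump.\<close>

lemma lnorm_cstar:
  assumes o: "\<rho> \<in> objs C" "\<sigma> \<in> objs C" and x: "x \<in> topspace X" and t: "t \<in> hom C \<rho> \<sigma>"
  shows "lnorm x \<rho> \<rho> (comp C \<rho> \<sigma> \<rho> (star C \<rho> \<sigma> t) t) = (lnorm x \<rho> \<sigma> t)\<^sup>2"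
proof (rule antisym)
  show "lnorm x \<rho> \<rho> (comp C \<rho> \<sigma> \<rho> (star C \<rho> \<sigma> t) t) \<le> (lnorm x \<rho> \<sigma> t)\<^sup>2"
    using lnorm_comp[OF o(1,2,1) x t star_closed[OF o t]] o t
    by (simp add: lnorm_star power2_eq_square)
next
  show "(lnorm x \<rho> \<sigma> t)\<^sup>2 \<le> lnorm x \<rho> \<rho> (comp C \<rho> \<sigma> \<rho> (star C \<rho> \<sigma> t) t)"
  proof (rule lnorm_greatest[OF o(1,1) x])
    fix g assume g: "g \<in> bumps x"
    note s = bump_sqrt[OF g]
    have "(lnorm x \<rho> \<sigma> t)\<^sup>2 \<le> (vnorm (arrs C \<rho> \<sigma>) (ract (\<lambda>y. sqrt (g y)) \<rho> \<sigma> t))\<^sup>2"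
      using lnorm_le[OF o x t s] lnorm_nonneg[OF o x t] by (rule power_mono)
    also have "\<dots> = vnorm (arrs C \<rho> \<rho>) (ract (\<lambda>y. sqrt (g y) * sqrt (g y)) \<rho> \<rho>
        (comp C \<rho> \<sigma> \<rho> (star C \<rho> \<sigma> t) t))"
      by (rule norm_ract_square[symmetric, OF bump_cont[OF s] o t])
    also have "ract (\<lambda>y. sqrt (g y) * sqrt (g y)) = ract g"
      using bump_range[OF g] by (intro act_cong) (simp flip: of_real_mult)
    finally show "(lnorm x \<rho> \<sigma> t)\<^sup>2 \<le>
        vnorm (arrs C \<rho> \<rho>) (ract g \<rho> \<rho> (comp C \<rho> \<sigma> \<rho> (star C \<rho> \<sigma> t) t))" .
  qed
qed

text \<open>A bump witnessing the value below \<open>c\<close> at \<open>x\<close> is also a bump at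
  every point of the open set on which it equals 1, and gives the same bound there.\<close>

lemma upper_semicontinuous_lnorm:
  assumes o: "\<rho> \<in> objs C" "\<sigma> \<in> objs C" and t: "t \<in> hom C \<rho> \<sigma>"
  shows "upper_semicontinuous_on X (\<lambda>x. lnorm x \<rho> \<sigma> t)"
  unfolding upper_semicontinuous_on_def
proof
  fix c
  show "openin X {x \<in> topspace X. lnorm x \<rho> \<sigma> t < c}"
    unfolding openin_subopen[of X "{x \<in> topspace X. lnorm x \<rho> \<sigma> t < c}"]
  proof
    fix x assume "x \<in> {x \<in> topspace X. lnorm x \<rho> \<sigma> t < c}"
    then have x: "x \<in> topspace X" "lnorm x \<rho> \<sigma> t < c"
      by auto
    then obtain g where g: "g \<in> bumps x" "vnorm (arrs C \<rho> \<sigma>) (ract g \<rho> \<sigma> t) < c"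
      using lnorm_lessE[OF o x] by blast
    then obtain U where U: "openin X U" "x \<in> U" "\<forall>y\<in>U. g y = 1"
      by (auto simp: bumps_def)
    have "y \<in> topspace X \<and> lnorm y \<rho> \<sigma> t < c" if y: "y \<in> U" for y
    proof -
      have "g \<in> bumps y" "y \<in> topspace X"
        using g U y openin_subset by (auto simp: bumps_def)
      then show ?thesis
        using lnorm_le[OF o _ t, of y g] g by simp
    qed
    then show "\<exists>U. openin X U \<and> x \<in> U \<and> U \<subseteq> {x \<in> topspace X. lnorm x \<rho> \<sigma> t < c}"
      using U by blast
  qed
qed

text \<open>With a partition of unity subordinate to finitely many truncations of norm less than \<open>c\<close>, the
  triangle inequality only gives a multiple of \<open>c\<close>.  The constant disappears after passing to the
  powers of \<open>t* \<circ> t\<close> with exponent \<open>2 ^ k\<close>, for which the C*-identity computes the norm.\<close>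

lemma norm_le_of_lnorm_less:
  assumes o: "\<rho> \<in> objs C" "\<sigma> \<in> objs C" and t: "t \<in> hom C \<rho> \<sigma>" and "0 \<le> c"
    and less: "\<And>x. x \<in> topspace X \<Longrightarrow> lnorm x \<rho> \<sigma> t < c"
  shows "vnorm (arrs C \<rho> \<sigma>) t \<le> c"
proof -
  \<comment> \<open>Repeated squaring: \<open>b k\<close> is the power of \<open>t* t\<close> with
    exponent \<open>2 ^ k\<close>, hence selfadjoint.\<close>
  define b where "b = rec_nat (comp C \<rho> \<sigma> \<rho> (star C \<rho> \<sigma> t) t) (\<lambda>_ a. comp C \<rho> \<rho> \<rho> a a)"
  have b_0: "b 0 = comp C \<rho> \<sigma> \<rho> (star C \<rho> \<sigma> t) t" and b_Suc: "b (Suc k) = comp C \<rho> \<rho> \<rho> (b k) (b k)" for k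
    by (auto simp: b_def)
  have b: "b k \<in> hom C \<rho> \<rho>" for k
    by (induction k) (simp_all add: b_0 b_Suc o t)
  have b_star: "star C \<rho> \<rho> (b k) = b k" for k
    by (induction k) (simp_all add: b_0 b_Suc o t b star_comp star_star)
  have b_norm: "vnorm (arrs C \<rho> \<rho>) (b k) = vnorm (arrs C \<rho> \<sigma>) t ^ (2 ^ Suc k)" for k
  proof (induction k)
    case 0
    then show ?case
      using cstar_identity[OF o t] by (simp add: b_0)
  next
    case (Suc k)
    then show ?case
      using cstar_identity[OF o(1,1) b[of k]]
      by (simp add: b_Suc b_star power_mult[symmetric] mult.commute)
  qed
  \<comment> \<open>Powers of \<open>g\<close> distribute over the factors of \<open>b k\<close>, so
    each factor \<open>t\<close> or \<open>t*\<close> is truncated once by \<open>g\<close>.\<close>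
  have b_trunc: "vnorm (arrs C \<rho> \<rho>) (ract (\<lambda>y. g y ^ (2 ^ Suc k)) \<rho> \<rho> (b k)) \<le>
      vnorm (arrs C \<rho> \<sigma>) (ract g \<rho> \<sigma> t) ^ (2 ^ Suc k)"
    if g: "continuous_map X euclideanreal g" for g k
  proof (induction k)
    case 0
    then show ?case
      using norm_ract_square[OF g o t] by (simp add: b_0 power2_eq_square)
  next
    case (Suc k)
    let ?h = "\<lambda>y. g y ^ (2 ^ Suc k)"
    have h: "continuous_map X euclideanreal ?h"
      using g by (intro continuous_intros)
    have "ract (\<lambda>y. g y ^ (2 ^ Suc (Suc k))) \<rho> \<rho> (b (Suc k)) =
        ract (\<lambda>y. ?h y * ?h y) \<rho> \<rho> (comp C \<rho> \<rho> \<rho> (b k) (b k))"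
      by (simp add: b_Suc power_add[symmetric] mult_2 del: of_real_power)
    also have "\<dots> = comp C \<rho> \<rho> \<rho> (ract ?h \<rho> \<rho> (b k)) (ract ?h \<rho> \<rho> (b k))"
      using o b h by (intro ract_comp) auto
    finally have "vnorm (arrs C \<rho> \<rho>) (ract (\<lambda>y. g y ^ (2 ^ Suc (Suc k))) \<rho> \<rho> (b (Suc k))) \<le>
        vnorm (arrs C \<rho> \<rho>) (ract ?h \<rho> \<rho> (b k)) * vnorm (arrs C \<rho> \<rho>) (ract ?h \<rho> \<rho> (b k))"
      using norm_comp[OF o(1,1,1), of "ract ?h \<rho> \<rho> (b k)" "ract ?h \<rho> \<rho> (b k)"]
        o b continuous_map_cof_real[OF h] by simp
    also have "\<dots> \<le> vnorm (arrs C \<rho> \<sigma>) (ract g \<rho> \<sigma> t) ^ (2 ^ Suc k) *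
        vnorm (arrs C \<rho> \<sigma>) (ract g \<rho> \<sigma> t) ^ (2 ^ Suc k)"
      using Suc o b t continuous_map_cof_real[OF h] continuous_map_cof_real[OF g]
      by (intro mult_mono) auto
    finally show ?case
      by (simp add: power_add[symmetric] mult_2)
  qed
  have "\<exists>g. g \<in> bumps x \<and> vnorm (arrs C \<rho> \<sigma>) (ract g \<rho> \<sigma> t) < c" if "x \<in> topspace X" for x
    by (rule lnorm_lessE[OF o that less[OF that]]) blast
  then obtain g where g: "\<And>x. x \<in> topspace X \<Longrightarrow> g x \<in> bumps x"
      "\<And>x. x \<in> topspace X \<Longrightarrow> vnorm (arrs C \<rho> \<sigma>) (ract (g x) \<rho> \<sigma> t) < c"
    by metis
  \<comment> \<open>A second bump, supported where \<open>g x\<close> equals 1, absorbs every power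
    of \<open>g x\<close>. The partition of unity can therefore be built from the \<open>k x\<close>
    once and for all, independently of the exponent.\<close>
  have "\<exists>k. k \<in> bumps x \<and> (\<forall>y\<in>topspace X. k y = 0 \<or> g x y = 1)" if x: "x \<in> topspace X" for x
  proof -
    obtain W where W: "openin X W" "x \<in> W" "\<forall>y\<in>W. g x y = 1"
      using g(1)[OF x] by (auto simp: bumps_def)
    obtain k where "k \<in> bumps x" "\<And>y. y \<in> topspace X - W \<Longrightarrow> k y = 0"
      by (rule bump_supported[OF W(1,2)]) blast
    then show ?thesis
      using W(3) by (intro exI[of _ k]) auto
  qed
  then obtain k where k: "\<And>x. x \<in> topspace X \<Longrightarrow> k x \<in> bumps x"
      and gk: "\<And>x y. \<lbrakk>x \<in> topspace X; y \<in> topspace X\<rbrakk> \<Longrightarrow> k x y = 0 \<or> g x y = 1"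
    by metis
  have "\<exists>U. openin X U \<and> x \<in> U \<and> (\<forall>y\<in>U. k x y = 1)" if "x \<in> topspace X" for x
    using k[OF that] by (auto simp: bumps_def)
  then obtain U where U: "\<And>x. x \<in> topspace X \<Longrightarrow> openin X (U x) \<and> x \<in> U x"
      "\<And>x y. \<lbrakk>x \<in> topspace X; y \<in> U x\<rbrakk> \<Longrightarrow> k x y = 1"
    by metis
  obtain F where F: "finite F" "F \<subseteq> topspace X" "topspace X \<subseteq> (\<Union>x\<in>F. U x)"
  proof -
    have "\<exists>\<F>. finite \<F> \<and> \<F> \<subseteq> U ` topspace X \<and> topspace X \<subseteq> \<Union>\<F>"
      using compact U(1) unfolding compact_space_alt by (elim allE[of _ "U ` topspace X"]) blast
    then show ?thesis
      using that by (metis finite_subset_image)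
  qed
  define s where "s = (\<lambda>y. \<Sum>x\<in>F. k x y)"
  have k_nonneg: "0 \<le> k x y" if "x \<in> F" "y \<in> topspace X" for x y
    using bump_range[OF k] that F(2) by blast
  have s_pos: "s y > 0" and k_le_s: "x \<in> F \<Longrightarrow> k x y \<le> s y" if y: "y \<in> topspace X" for x y
  proof -
    show le: "k x y \<le> s y" if "x \<in> F" for x
      unfolding s_def using F(1) k_nonneg y that by (intro member_le_sum) auto
    obtain x where "x \<in> F" "y \<in> U x"
      using F(3) y by blast
    then show "s y > 0"
      using le[of x] U(2)[of x y] F(2) by force
  qed
  \<comment> \<open>Dividing by the sum gives a partition of unity; the sum is positive on
    \<open>X\<close> because at each point some \<open>k x\<close> with \<open>x\<close> in
    \<open>F\<close> equals 1.\<close>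
  define h where "h x y = k x y / s y" for x y
  have k_cont: "continuous_map X euclideanreal (k x)" if "x \<in> F" for x
    using that F(2) by (intro bump_cont[OF k]) auto
  have h_cont: "continuous_map X euclideanreal (h x)" if "x \<in> F" for x
    unfolding h_def s_def
  proof (intro continuous_map_real_divide continuous_map_sum)
    show "(\<Sum>x\<in>F. k x y) \<noteq> 0" if "y \<in> topspace X" for y
      using s_pos[OF that] by (simp add: s_def)
  qed (use that F(1) k_cont in auto)
  have h_sum: "(\<Sum>x\<in>F. h x y) = 1" if "y \<in> topspace X" for y
    using s_pos[OF that] by (simp add: h_def s_def flip: sum_divide_distrib)
  have h_trunc: "vnorm (arrs C \<rho> \<rho>) (ract (h x) \<rho> \<rho> (b N)) \<le> c ^ (2 ^ Suc N)"
    if x: "x \<in> F" for x N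
  proof -
    let ?g = "\<lambda>y. g x y ^ (2 ^ Suc N)"
    have xX: "x \<in> topspace X"
      using x F by blast
    have gc: "continuous_map X euclideanreal (g x)"
      using g(1) xX by (blast intro: bump_cont)
    have gc': "continuous_map X euclideanreal ?g"
      using gc by (intro continuous_intros)
    \<comment> \<open>Where \<open>h x\<close> is nonzero, \<open>g x\<close> is 1, so the power of
      \<open>g x\<close> can be inserted at no cost and \<open>b_trunc\<close> becomes
      applicable.\<close>
    have "ract (h x) = act (\<lambda>y. complex_of_real (h x y) * complex_of_real (?g y))"
      using gk[OF xX] by (intro act_cong) (force simp: h_def)
    then have "ract (h x) \<rho> \<rho> (b N) = ract (h x) \<rho> \<rho> (ract ?g \<rho> \<rho> (b N))"
      using continuous_map_cof_real[OF h_cont[OF x]] continuous_map_cof_real[OF gc'] o b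
      by (simp only: act_mult)
    also have "vnorm (arrs C \<rho> \<rho>) \<dots> \<le> vnorm (arrs C \<rho> \<rho>) (ract ?g \<rho> \<rho> (b N))"
    proof (rule norm_ract_le[OF h_cont[OF x] _ o(1,1)])
      show "\<bar>h x y\<bar> \<le> 1" if "y \<in> topspace X" for y
        using s_pos[OF that] k_le_s[OF that x] k_nonneg[OF x that] by (simp add: h_def)
      show "ract ?g \<rho> \<rho> (b N) \<in> hom C \<rho> \<rho>"
        using continuous_map_cof_real[OF gc'] o b by (intro act_closed)
    qed
    also have "\<dots> \<le> vnorm (arrs C \<rho> \<sigma>) (ract (g x) \<rho> \<sigma> t) ^ (2 ^ Suc N)"
      by (rule b_trunc[OF gc])
    also have "\<dots> \<le> c ^ (2 ^ Suc N)"
      using g(2)[OF xX] o t continuous_map_cof_real[OF gc] by (intro power_mono) auto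
    finally show ?thesis .
  qed
  have power_le: "vnorm (arrs C \<rho> \<sigma>) t ^ (2 ^ Suc N) \<le> card F * c ^ (2 ^ Suc N)" for N
  proof -
    \<comment> \<open>On an empty space \<open>F\<close> is empty, and this says that 0 and 1 act
      alike, so that all arrows vanish.\<close>
    have "ract (\<lambda>y. \<Sum>x\<in>F. h x y) = act (\<lambda>y. 1)"
      using h_sum by (intro act_cong) (simp del: of_real_sum)
    then have "vnorm (arrs C \<rho> \<sigma>) t ^ (2 ^ Suc N) =
        vnorm (arrs C \<rho> \<rho>) (ract (\<lambda>y. \<Sum>x\<in>F. h x y) \<rho> \<rho> (b N))"
      using b[of N] o b_norm[of N] by simp
    also have "\<dots> \<le> (\<Sum>x\<in>F. vnorm (arrs C \<rho> \<rho>) (ract (h x) \<rho> \<rho> (b N)))"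
      using F(1) h_cont o b by (intro norm_ract_sum_le) auto
    also have "\<dots> \<le> card F * c ^ (2 ^ Suc N)"
      using h_trunc by (intro sum_bounded_above)
    finally show ?thesis .
  qed
  show ?thesis
    by (rule le_of_power_le[OF norm_hom_nonneg[OF o t] \<open>0 \<le> c\<close> power_le])
qed

end

section \<open>The fiber categories\<close>

context compact_CX_category
begin

section \<open>The fiber ideal as a kernel\<close>

context
  fixes x
  assumes x: "x \<in> topspace X"
begin

text \<open>Composition is well defined modulo null arrows: the factors are changed one at a time,
  and submultiplicativity kills each difference.\<close>

lemma lnorm_diff_comp:
  assumes o: "\<rho> \<in> objs C" "\<sigma> \<in> objs C" "\<tau> \<in> objs C"
    and t: "s \<in> hom C \<rho> \<sigma>" "s' \<in> hom C \<rho> \<sigma>" "t \<in> hom C \<sigma> \<tau>" "t' \<in> hom C \<sigma> \<tau>"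
    and z: "lnorm x \<rho> \<sigma> (vdiff (arrs C \<rho> \<sigma>) s s') = 0"
      "lnorm x \<sigma> \<tau> (vdiff (arrs C \<sigma> \<tau>) t t') = 0"
  shows "lnorm x \<rho> \<tau> (vdiff (arrs C \<rho> \<tau>) (comp C \<rho> \<sigma> \<tau> t s) (comp C \<rho> \<sigma> \<tau> t' s')) = 0"
proof -
  interpret Q: quotient_seminorm "arrs C \<rho> \<tau>" "lnorm x \<rho> \<tau>"
    by (rule quotient_seminorm_lnorm[OF o(1,3) x])
  show ?thesis
  proof (rule Q.sn_diff_trans)
    show "lnorm x \<rho> \<tau> (vdiff (arrs C \<rho> \<tau>) (comp C \<rho> \<sigma> \<tau> t s) (comp C \<rho> \<sigma> \<tau> t' s)) = 0"
      using lnorm_comp[OF o x t(1), of "vdiff (arrs C \<sigma> \<tau>) t t'"] o t z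
      by (intro Q.sn_antisym) (simp_all add: comp_diff_left)
    show "lnorm x \<rho> \<tau> (vdiff (arrs C \<rho> \<tau>) (comp C \<rho> \<sigma> \<tau> t' s) (comp C \<rho> \<sigma> \<tau> t' s')) = 0"
      using lnorm_comp[OF o x _ t(4), of "vdiff (arrs C \<rho> \<sigma>) s s'"] o t z
      by (intro Q.sn_antisym) (simp_all add: comp_diff_right)
  qed (use o t in simp_all)
qed

lemma lnorm_diff_star:
  assumes "\<rho> \<in> objs C" "\<sigma> \<in> objs C" "s \<in> hom C \<rho> \<sigma>" "s' \<in> hom C \<rho> \<sigma>"
    and "lnorm x \<rho> \<sigma> (vdiff (arrs C \<rho> \<sigma>) s s') = 0"
  shows "lnorm x \<sigma> \<rho> (vdiff (arrs C \<sigma> \<rho>) (star C \<rho> \<sigma> s) (star C \<rho> \<sigma> s')) = 0"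
  using assms by (simp add: lnorm_star flip: star_diff)

text \<open>The generators are null by \<open>lnorm_act_vanishing\<close>, and the kernel is a
  closed subspace. Conversely, a null element \<open>a\<close> is approximated by the generators
  \<open>(1 - g) a\<close>: the error is the truncation of \<open>a\<close> by \<open>g\<close>,
  whose norm can be made arbitrarily small.\<close>

lemma fiber_ideal_eq:
  assumes o: "\<rho> \<in> objs C"
  shows "fiber_ideal X C \<phi> x \<rho> = quotient_seminorm.sn_kernel (arrs C \<rho> \<rho>) (lnorm x \<rho> \<rho>)"
proof -
  interpret Q: quotient_seminorm "arrs C \<rho> \<rho>" "lnorm x \<rho> \<rho>"
    by (rule quotient_seminorm_lnorm[OF o o x])
  let ?S = "{fst (\<phi> f) \<rho> \<rho> a | f a. f \<in> cont_fun X \<and> f x = 0 \<and> a \<in> hom C \<rho> \<rho>}"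
  have act_S: "act f \<rho> \<rho> a \<in> ?S"
    if "continuous_map X euclidean f" "f x = 0" "a \<in> hom C \<rho> \<rho>" for f a
    using that x restrict_cont_fun[OF that(1)]
    by (auto simp: act_def intro!: exI[of _ "restrict f (topspace X)"])
  have "closed_subspace (arrs C \<rho> \<rho>) hull ?S = Q.sn_kernel"
  proof (rule hull_unique)
    show "?S \<subseteq> Q.sn_kernel"
    proof clarify
      fix f a assume f: "f \<in> cont_fun X" "f x = 0" and a: "a \<in> hom C \<rho> \<rho>"
      then have "continuous_map X euclidean f"
        by (simp add: cont_fun_def)
      then show "fst (\<phi> f) \<rho> \<rho> a \<in> Q.sn_kernel"
        using f a o x by (simp add: Q.sn_kernel_def lnorm_act_vanishing flip: act_cont_fun)
    qed
  next
    show "closed_subspace (arrs C \<rho> \<rho>) Q.sn_kernel"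
      by (rule Q.closed_subspace_sn_kernel)
  next
    fix T assume T: "?S \<subseteq> T" "closed_subspace (arrs C \<rho> \<rho>) T"
    show "Q.sn_kernel \<subseteq> T"
    proof
      fix a assume "a \<in> Q.sn_kernel"
      then have a: "a \<in> hom C \<rho> \<rho>" "lnorm x \<rho> \<rho> a = 0"
        by (auto simp: Q.sn_kernel_def)
      show "a \<in> T"
      proof (rule Q.closedin_vmetricD)
        show "closedin (mtopology_of (vmetric (arrs C \<rho> \<rho>))) T"
          using T(2) by (simp add: closed_subspace_def)
        fix e :: real assume "e > 0"
        then have "lnorm x \<rho> \<rho> a < e"
          using a by simp
        then obtain g where g: "g \<in> bumps x" "vnorm (arrs C \<rho> \<rho>) (ract g \<rho> \<rho> a) < e"
          by (rule lnorm_lessE[OF o o x]) blast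
        let ?w = "vdiff (arrs C \<rho> \<rho>) a (ract g \<rho> \<rho> a)"
        have "?w \<in> ?S"
          unfolding diff_act[OF o o x bump_ccont[OF g(1)] a(1)]
          using a g(1) by (intro act_S)
            (auto intro!: continuous_map_diff simp: bump_ccont bump_at)
        moreover have "vdiff (arrs C \<rho> \<rho>) a ?w = ract g \<rho> \<rho> a"
          using a o bump_ccont[OF g(1)]
          by (simp add: vdiff_def Q.scale_add)
        ultimately show "\<exists>w\<in>T. vnorm (arrs C \<rho> \<rho>) (vdiff (arrs C \<rho> \<rho>) a w) < e"
          using T(1) g(2) by (intro bexI[of _ ?w]) auto
      qed (rule a)
    qed
  qed
  then show ?thesis
    by (simp add: fiber_ideal_def closed_span_def)
qed

section \<open>The fiber algebras\<close>

abbreviation fcls :: "'o \<Rightarrow> 'a \<Rightarrow> 'a set" where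
  "fcls \<equiv> fiber_class X C \<phi> x"

abbreviation falg :: "'o \<Rightarrow> 'a set cspace" where
  "falg \<equiv> fiber_alg X C \<phi> x"

context
  fixes \<rho>
  assumes o: "\<rho> \<in> objs C"
begin

interpretation Q: quotient_seminorm "arrs C \<rho> \<rho>" "lnorm x \<rho> \<rho>"
  by (rule quotient_seminorm_lnorm[OF o o x])

lemma fcls_eq_iff:
  "\<lbrakk>a \<in> hom C \<rho> \<rho>; b \<in> hom C \<rho> \<rho>\<rbrakk>
    \<Longrightarrow> fcls \<rho> a = fcls \<rho> b \<longleftrightarrow> lnorm x \<rho> \<rho> (vdiff (arrs C \<rho> \<rho>) a b) = 0"
  by (simp add: fiber_class_def fiber_ideal_eq o Q.cls_eq_iff)

lemma rep_fcls:
  "a \<in> hom C \<rho> \<rho> \<Longrightarrow> rep (fcls \<rho> a) \<in> hom C \<rho> \<rho>"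
  "a \<in> hom C \<rho> \<rho> \<Longrightarrow> lnorm x \<rho> \<rho> (vdiff (arrs C \<rho> \<rho>) (rep (fcls \<rho> a)) a) = 0"
  by (simp_all add: fiber_class_def fiber_ideal_eq o Q.rep_cls)

lemma rep_falg:
  assumes "A \<in> vecs (falg \<rho>)"
  shows "rep A \<in> hom C \<rho> \<rho>" "fcls \<rho> (rep A) = A"
  using Q.rep_quotient[of A] assms
  by (simp_all add: fiber_class_def fiber_alg_def fiber_ideal_eq o)

lemma banach_falg: "complex_banach (falg \<rho>)"
  by (simp add: fiber_alg_def fiber_ideal_eq o Q.banach_quotient)

lemma fcls_closed: "a \<in> hom C \<rho> \<rho> \<Longrightarrow> fcls \<rho> a \<in> vecs (falg \<rho>)"
  by (simp add: fiber_class_def fiber_alg_def fiber_ideal_eq o Q.vecs_quotient)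

lemma vzero_falg: "vzero (falg \<rho>) = fcls \<rho> (vzero (arrs C \<rho> \<rho>))"
  by (simp add: fiber_class_def fiber_alg_def fiber_ideal_eq o Q.vzero_quotient)

lemma vadd_falg:
  "\<lbrakk>a \<in> hom C \<rho> \<rho>; b \<in> hom C \<rho> \<rho>\<rbrakk>
    \<Longrightarrow> vadd (falg \<rho>) (fcls \<rho> a) (fcls \<rho> b) = fcls \<rho> (vadd (arrs C \<rho> \<rho>) a b)"
  by (simp add: fiber_class_def fiber_alg_def fiber_ideal_eq o Q.vadd_quotient)

lemma vnorm_falg: "a \<in> hom C \<rho> \<rho> \<Longrightarrow> vnorm (falg \<rho>) (fcls \<rho> a) = lnorm x \<rho> \<rho> a"
  by (simp add: fiber_class_def fiber_alg_def fiber_ideal_eq o Q.vnorm_quotient)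

lemma fiber_alg_mult_fcls:
  "\<lbrakk>a \<in> hom C \<rho> \<rho>; b \<in> hom C \<rho> \<rho>\<rbrakk>
    \<Longrightarrow> fiber_alg_mult X C \<phi> x \<rho> (fcls \<rho> a) (fcls \<rho> b) = fcls \<rho> (comp C \<rho> \<rho> \<rho> a b)"
  by (simp add: fiber_alg_mult_def fcls_eq_iff rep_fcls o lnorm_diff_comp)

end

text \<open>Balancing moves the second factor of a tensor into the first, leaving the unit behind,
  so a formal sum of tensors is represented by a single arrow. Other representatives than those
  chosen by \<open>rep\<close> would change it by a null arrow only.\<close>

definition fiber_eval :: "'o \<Rightarrow> 'o \<Rightarrow> ('a \<times> 'a set) list \<Rightarrow> 'a" where
  "fiber_eval \<rho> \<sigma> z =
     foldr (vadd (arrs C \<rho> \<sigma>)) (map (\<lambda>(e, f). comp C \<rho> \<rho> \<sigma> e (rep f)) z) (vzero (arrs C \<rho> \<sigma>))"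

lemma fiber_eval_simps [simp]:
  "fiber_eval \<rho> \<sigma> [] = vzero (arrs C \<rho> \<sigma>)"
  "fiber_eval \<rho> \<sigma> ((e, f) # z) =
    vadd (arrs C \<rho> \<sigma>) (comp C \<rho> \<rho> \<sigma> e (rep f)) (fiber_eval \<rho> \<sigma> z)"
  by (simp_all add: fiber_eval_def)

section \<open>The tensor product defining a fiber arrow space\<close>

context
  fixes \<rho> \<sigma>
  assumes o: "\<rho> \<in> objs C" "\<sigma> \<in> objs C"
begin

interpretation A: complex_banach "arrs C \<rho> \<sigma>"
  by (rule banach[OF o])

interpretation B: complex_banach "falg \<rho>"
  by (rule banach_falg[OF o(1)])

lemma fiber_eval_closed:
  "z \<in> lists (hom C \<rho> \<sigma> \<times> vecs (falg \<rho>)) \<Longrightarrow> fiber_eval \<rho> \<sigma> z \<in> hom C \<rho> \<sigma>"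
  by (induction z) (auto simp: o rep_falg)

lemma fiber_eval_append:
  "\<lbrakk>z \<in> lists (hom C \<rho> \<sigma> \<times> vecs (falg \<rho>)); z' \<in> lists (hom C \<rho> \<sigma> \<times> vecs (falg \<rho>))\<rbrakk>
    \<Longrightarrow> fiber_eval \<rho> \<sigma> (z @ z') = vadd (arrs C \<rho> \<sigma>) (fiber_eval \<rho> \<sigma> z) (fiber_eval \<rho> \<sigma> z')"
proof (induction z)
  case (Cons p z)
  obtain e f where p: "p = (e, f)" "e \<in> hom C \<rho> \<sigma>" "f \<in> vecs (falg \<rho>)"
    using Cons.prems by (cases p) auto
  then show ?case
    using Cons o rep_falg[OF o(1) p(3)] fiber_eval_closed[of z] fiber_eval_closed[of z']
    by (simp add: A.add_assoc)
qed (simp add: fiber_eval_closed)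

lemma fiber_eval_scale:
  "z \<in> lists (hom C \<rho> \<sigma> \<times> vecs (falg \<rho>)) \<Longrightarrow>
    fiber_eval \<rho> \<sigma> (map (\<lambda>(e, f). (vscale (arrs C \<rho> \<sigma>) c e, f)) z) =
    vscale (arrs C \<rho> \<sigma>) c (fiber_eval \<rho> \<sigma> z)"
proof (induction z)
  case (Cons p z)
  obtain e f where p: "p = (e, f)" "e \<in> hom C \<rho> \<sigma>" "f \<in> vecs (falg \<rho>)"
    using Cons.prems by (cases p) auto
  then show ?case
    using Cons o rep_falg[OF o(1) p(3)] fiber_eval_closed[of z]
    by (simp add: A.scale_add comp_scale_left)
qed simp

abbreviation (input) elementary_ip :: "'a \<Rightarrow> 'a set \<Rightarrow> 'a \<Rightarrow> 'a set \<Rightarrow> 'a set" where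
  "elementary_ip e f e' f' \<equiv> fiber_alg_mult X C \<phi> x \<rho> (fiber_alg_star X C \<phi> x \<rho> f)
     (fiber_alg_mult X C \<phi> x \<rho> (fcls \<rho> (comp C \<rho> \<sigma> \<rho> (star C \<rho> \<sigma> e) e')) f')"

text \<open>Associativity and \<open>star_comp\<close> regroup the product
  \<open>f* (e* e') f'\<close> as the adjoint of \<open>e f\<close> composed with
  \<open>e' f'\<close>.\<close>

lemma elementary_ip:
  assumes e: "e \<in> hom C \<rho> \<sigma>" "e' \<in> hom C \<rho> \<sigma>" and f: "f \<in> vecs (falg \<rho>)" "f' \<in> vecs (falg \<rho>)"
  shows "elementary_ip e f e' f' =
    fcls \<rho> (comp C \<rho> \<sigma> \<rho> (star C \<rho> \<sigma> (comp C \<rho> \<rho> \<sigma> e (rep f))) (comp C \<rho> \<rho> \<sigma> e' (rep f')))"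
proof -
  note r = rep_falg[OF o(1) f(1)] rep_falg[OF o(1) f(2)]
  have "fiber_alg_mult X C \<phi> x \<rho> (fcls \<rho> (comp C \<rho> \<sigma> \<rho> (star C \<rho> \<sigma> e) e')) f' =
      fcls \<rho> (comp C \<rho> \<rho> \<rho> (comp C \<rho> \<sigma> \<rho> (star C \<rho> \<sigma> e) e') (rep f'))"
    using fiber_alg_mult_fcls[OF o(1), of "comp C \<rho> \<sigma> \<rho> (star C \<rho> \<sigma> e) e'" "rep f'"] o e r by simp
  then show ?thesis
    using o e r by (simp add: fiber_alg_star_def fiber_alg_mult_fcls star_comp comp_assoc)
qed

lemma elementary_ip_row_closed:
  assumes e: "e \<in> hom C \<rho> \<sigma>" and f: "f \<in> vecs (falg \<rho>)"
    and z: "z \<in> lists (hom C \<rho> \<sigma> \<times> vecs (falg \<rho>))"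
  shows "set (map (\<lambda>(e', f'). elementary_ip e f e' f') z) \<subseteq> vecs (falg \<rho>)"
proof -
  have "elementary_ip e f e' f' \<in> vecs (falg \<rho>)" if "e' \<in> hom C \<rho> \<sigma>" "f' \<in> vecs (falg \<rho>)" for e' f'
    using e f that o rep_falg[OF o(1) f] rep_falg[OF o(1) that(2)]
    by (subst elementary_ip) (auto intro!: fcls_closed)
  then show ?thesis
    using z by (induction z) auto
qed

lemma elementary_ip_sum:
  assumes e: "e \<in> hom C \<rho> \<sigma>" and f: "f \<in> vecs (falg \<rho>)"
    and z: "z \<in> lists (hom C \<rho> \<sigma> \<times> vecs (falg \<rho>))"
  shows "foldr (vadd (falg \<rho>)) (map (\<lambda>(e', f'). elementary_ip e f e' f') z) (vzero (falg \<rho>)) =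
    fcls \<rho> (comp C \<rho> \<sigma> \<rho> (star C \<rho> \<sigma> (comp C \<rho> \<rho> \<sigma> e (rep f))) (fiber_eval \<rho> \<sigma> z))"
  using z
proof (induction z)
  case Nil
  then show ?case
    using o e rep_falg[OF o(1) f] by (simp add: vzero_falg comp_zero_right)
next
  case (Cons p z)
  obtain e' f' where p: "p = (e', f')" "e' \<in> hom C \<rho> \<sigma>" "f' \<in> vecs (falg \<rho>)"
    using Cons by (cases p) auto
  then show ?case
    using Cons o e f rep_falg[OF o(1) f] rep_falg[OF o(1) p(3)] fiber_eval_closed[of z]
    by (simp add: elementary_ip vadd_falg comp_add_right)
qed

text \<open>Both lists enter only through their evaluations. With \<open>lnorm_cstar\<close> this
  identifies the seminorm of the tensor product with \<open>lnorm x\<close> of the evaluated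
  arrow.\<close>

lemma tensor_ip_fiber:
  assumes z: "z \<in> lists (hom C \<rho> \<sigma> \<times> vecs (falg \<rho>))"
    and z': "z' \<in> lists (hom C \<rho> \<sigma> \<times> vecs (falg \<rho>))"
  shows "tensor_ip (\<lambda>t t'. comp C \<rho> \<sigma> \<rho> (star C \<rho> \<sigma> t) t')
      (\<lambda>a. fiber_alg_mult X C \<phi> x \<rho> (fcls \<rho> a))
      (\<lambda>A B. fiber_alg_mult X C \<phi> x \<rho> (fiber_alg_star X C \<phi> x \<rho> A) B) (falg \<rho>) z z' =
    fcls \<rho> (comp C \<rho> \<sigma> \<rho> (star C \<rho> \<sigma> (fiber_eval \<rho> \<sigma> z)) (fiber_eval \<rho> \<sigma> z'))"
  using z
proof (induction z)
  case Nil
  then show ?case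
    using o fiber_eval_closed[OF z'] by (simp add: tensor_ip_def vzero_falg star_zero comp_zero_left)
next
  case (Cons p z)
  obtain e f where p: "p = (e, f)" "e \<in> hom C \<rho> \<sigma>" "f \<in> vecs (falg \<rho>)"
    using Cons by (cases p) auto
  note r = rep_falg[OF o(1) p(3)]
  \<comment> \<open>The double sum runs row by row: \<open>?M\<close> is the row of the head
    \<open>(e, f)\<close>, and \<open>?N\<close> collects the rows of the tail.\<close>
  let ?M = "map (\<lambda>(e', f'). elementary_ip e f e' f') z'"
  let ?N = "concat (map (\<lambda>(e, f). map (\<lambda>(e', f'). elementary_ip e f e' f') z') z)"
  have "foldr (vadd (falg \<rho>)) (?M @ ?N) (vzero (falg \<rho>)) =
      vadd (falg \<rho>) (foldr (vadd (falg \<rho>)) ?M (vzero (falg \<rho>)))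
        (foldr (vadd (falg \<rho>)) ?N (vzero (falg \<rho>)))"
  proof (rule B.foldr_add_append)
    show "set ?M \<subseteq> vecs (falg \<rho>)"
      using p z' by (intro elementary_ip_row_closed)
    show "set ?N \<subseteq> vecs (falg \<rho>)"
      using Cons.hyps(2)
    proof (induction z)
      case (Cons q w)
      then show ?case
        using elementary_ip_row_closed[OF _ _ z'] by (cases q) (simp del: set_map)
    qed simp
  qed
  then show ?case
    using Cons p o r z' fiber_eval_closed[OF z'] fiber_eval_closed[of z]
    by (simp add: tensor_ip_def elementary_ip_sum vadd_falg star_add comp_add_left
        del: foldr_append)
qed

text \<open>Evaluating the tensor of \<open>t\<close> with the unit composes \<open>t\<close> with a
  representative of the class of the identity. This is congruent to the identity but need not equal
  it, so \<open>t\<close> is recovered only up to a null arrow.\<close>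

lemma seminorm_presentation_fiber:
  "seminorm_presentation (arrs C \<rho> \<sigma>) (lnorm x \<rho> \<sigma>) (fiber_pre X C \<phi> x \<rho> \<sigma>) (fiber_eval \<rho> \<sigma>)
    (\<lambda>t. [(t, fcls \<rho> (ident C \<rho>))])"
proof -
  interpret Q: quotient_seminorm "arrs C \<rho> \<sigma>" "lnorm x \<rho> \<sigma>"
    by (rule quotient_seminorm_lnorm[OF o x])
  have vecs: "vecs (fiber_pre X C \<phi> x \<rho> \<sigma>) = lists (hom C \<rho> \<sigma> \<times> vecs (falg \<rho>))"
    by (simp add: fiber_pre_def pre_tensor_def)
  have simps: "vzero (fiber_pre X C \<phi> x \<rho> \<sigma>) = []" "vadd (fiber_pre X C \<phi> x \<rho> \<sigma>) = (@)"
    "vscale (fiber_pre X C \<phi> x \<rho> \<sigma>) = (\<lambda>c. map (\<lambda>(e, f). (vscale (arrs C \<rho> \<sigma>) c e, f)))"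
    by (simp_all add: fiber_pre_def pre_tensor_def)
  show ?thesis
  proof
    fix z assume z: "z \<in> vecs (fiber_pre X C \<phi> x \<rho> \<sigma>)"
    show "vscale (fiber_pre X C \<phi> x \<rho> \<sigma>) c z \<in> vecs (fiber_pre X C \<phi> x \<rho> \<sigma>)" for c
      using z by (fastforce simp: vecs simps o)
    have "fiber_eval \<rho> \<sigma> z \<in> hom C \<rho> \<sigma>"
      using z by (simp add: vecs fiber_eval_closed)
    then show "vnorm (fiber_pre X C \<phi> x \<rho> \<sigma>) z = lnorm x \<rho> \<sigma> (fiber_eval \<rho> \<sigma> z)"
      using z o x
      by (simp add: vecs) (simp add: fiber_pre_def pre_tensor_def tensor_ip_fiber vnorm_falg
          lnorm_cstar lnorm_nonneg)
  next
    fix t assume t: "t \<in> hom C \<rho> \<sigma>"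
    have i: "ident C \<rho> \<in> hom C \<rho> \<rho>"
      using o by (simp add: ident_hom)
    show "[(t, fcls \<rho> (ident C \<rho>))] \<in> vecs (fiber_pre X C \<phi> x \<rho> \<sigma>)"
      using t i o by (simp add: vecs fcls_closed)
    show "lnorm x \<rho> \<sigma> (vdiff (arrs C \<rho> \<sigma>) (fiber_eval \<rho> \<sigma> [(t, fcls \<rho> (ident C \<rho>))]) t) = 0"
      using lnorm_diff_comp[OF o(1,1,2) rep_fcls(1)[OF o(1) i] i t t rep_fcls(2)[OF o(1) i]]
        t i o rep_fcls[OF o(1) i] by (simp add: comp_ident)
  qed (auto simp: vecs simps fiber_eval_closed fiber_eval_append fiber_eval_scale)
qed

interpretation S: seminorm_presentation "arrs C \<rho> \<sigma>" "lnorm x \<rho> \<sigma>" "fiber_pre X C \<phi> x \<rho> \<sigma>"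
  "fiber_eval \<rho> \<sigma>" "\<lambda>t. [(t, fcls \<rho> (ident C \<rho>))]"
  by (rule seminorm_presentation_fiber)

lemma fiber_proj_eq_lim_class: "t \<in> hom C \<rho> \<sigma> \<Longrightarrow> fiber_proj X C \<phi> x \<rho> \<sigma> t = S.lim_class t"
  by (simp add: fiber_proj_def S.compl_class_elem)

lemma fiber_proj_eq_iff:
  "\<lbrakk>t \<in> hom C \<rho> \<sigma>; t' \<in> hom C \<rho> \<sigma>\<rbrakk> \<Longrightarrow> fiber_proj X C \<phi> x \<rho> \<sigma> t = fiber_proj X C \<phi> x \<rho> \<sigma> t' \<longleftrightarrow>
     lnorm x \<rho> \<sigma> (vdiff (arrs C \<rho> \<sigma>) t t') = 0"
  by (simp add: fiber_proj_eq_lim_class S.lim_class_eq_iff)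

text \<open>Surjectivity of the projections makes the operations induced by them defined on all
  fiber arrows.\<close>

lemma vecs_fiber_arrs: "vecs (fiber_arrs X C \<phi> x \<rho> \<sigma>) = fiber_proj X C \<phi> x \<rho> \<sigma> ` hom C \<rho> \<sigma>"
  by (simp add: fiber_arrs_def S.vecs_completion fiber_proj_eq_lim_class cong: image_cong)

lemma vadd_fiber_arrs:
  "\<lbrakk>t \<in> hom C \<rho> \<sigma>; t' \<in> hom C \<rho> \<sigma>\<rbrakk>
    \<Longrightarrow> vadd (fiber_arrs X C \<phi> x \<rho> \<sigma>) (fiber_proj X C \<phi> x \<rho> \<sigma> t) (fiber_proj X C \<phi> x \<rho> \<sigma> t') =
        fiber_proj X C \<phi> x \<rho> \<sigma> (vadd (arrs C \<rho> \<sigma>) t t')"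
  by (simp add: fiber_arrs_def S.vadd_completion fiber_proj_eq_lim_class)

lemma vscale_fiber_arrs:
  "t \<in> hom C \<rho> \<sigma> \<Longrightarrow> vscale (fiber_arrs X C \<phi> x \<rho> \<sigma>) c (fiber_proj X C \<phi> x \<rho> \<sigma> t) =
     fiber_proj X C \<phi> x \<rho> \<sigma> (vscale (arrs C \<rho> \<sigma>) c t)"
  by (simp add: fiber_arrs_def S.vscale_completion fiber_proj_eq_lim_class)

lemma vnorm_fiber_arrs:
  "t \<in> hom C \<rho> \<sigma> \<Longrightarrow> vnorm (fiber_arrs X C \<phi> x \<rho> \<sigma>) (fiber_proj X C \<phi> x \<rho> \<sigma> t) = lnorm x \<rho> \<sigma> t"
  by (simp add: fiber_arrs_def S.vnorm_completion fiber_proj_eq_lim_class)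

lemma banach_fiber_arrs: "complex_banach (fiber_arrs X C \<phi> x \<rho> \<sigma>)"
  unfolding fiber_arrs_def by (rule S.banach_completion)

end

text \<open>The description in \<open>fiber_comp\<close> has a unique solution because, by
  \<open>lnorm_diff_comp\<close>, the class of a composite depends only on the classes of its
  factors.\<close>

lemma fiber_comp_proj:
  assumes o: "\<rho> \<in> objs C" "\<sigma> \<in> objs C" "\<tau> \<in> objs C" and t: "t' \<in> hom C \<rho> \<sigma>" "t \<in> hom C \<sigma> \<tau>"
  shows "fiber_comp X C \<phi> x \<rho> \<sigma> \<tau> (fiber_proj X C \<phi> x \<sigma> \<tau> t) (fiber_proj X C \<phi> x \<rho> \<sigma> t') =
    fiber_proj X C \<phi> x \<rho> \<tau> (comp C \<rho> \<sigma> \<tau> t t')"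
  unfolding fiber_comp_def
proof (rule the_equality)
  fix w
  assume "\<exists>s\<in>hom C \<sigma> \<tau>. \<exists>s'\<in>hom C \<rho> \<sigma>.
      fiber_proj X C \<phi> x \<sigma> \<tau> t = fiber_proj X C \<phi> x \<sigma> \<tau> s \<and>
      fiber_proj X C \<phi> x \<rho> \<sigma> t' = fiber_proj X C \<phi> x \<rho> \<sigma> s' \<and>
      w = fiber_proj X C \<phi> x \<rho> \<tau> (comp C \<rho> \<sigma> \<tau> s s')"
  then obtain s s' where s: "s \<in> hom C \<sigma> \<tau>" "s' \<in> hom C \<rho> \<sigma>"
      "fiber_proj X C \<phi> x \<sigma> \<tau> s = fiber_proj X C \<phi> x \<sigma> \<tau> t"
      "fiber_proj X C \<phi> x \<rho> \<sigma> s' = fiber_proj X C \<phi> x \<rho> \<sigma> t'"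
      "w = fiber_proj X C \<phi> x \<rho> \<tau> (comp C \<rho> \<sigma> \<tau> s s')"
    by metis
  then show "w = fiber_proj X C \<phi> x \<rho> \<tau> (comp C \<rho> \<sigma> \<tau> t t')"
    using o t by (simp add: fiber_proj_eq_iff lnorm_diff_comp)
qed (use t in blast)

lemma fiber_star_proj:
  assumes o: "\<rho> \<in> objs C" "\<sigma> \<in> objs C" and t: "t \<in> hom C \<rho> \<sigma>"
  shows "fiber_star X C \<phi> x \<rho> \<sigma> (fiber_proj X C \<phi> x \<rho> \<sigma> t) =
    fiber_proj X C \<phi> x \<sigma> \<rho> (star C \<rho> \<sigma> t)"
  unfolding fiber_star_def
proof (rule the_equality)
  fix w
  assume "\<exists>s\<in>hom C \<rho> \<sigma>. fiber_proj X C \<phi> x \<rho> \<sigma> t = fiber_proj X C \<phi> x \<rho> \<sigma> s \<and>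
      w = fiber_proj X C \<phi> x \<sigma> \<rho> (star C \<rho> \<sigma> s)"
  then obtain s where "s \<in> hom C \<rho> \<sigma>" "fiber_proj X C \<phi> x \<rho> \<sigma> s = fiber_proj X C \<phi> x \<rho> \<sigma> t"
      "w = fiber_proj X C \<phi> x \<sigma> \<rho> (star C \<rho> \<sigma> s)"
    by metis
  then show "w = fiber_proj X C \<phi> x \<sigma> \<rho> (star C \<rho> \<sigma> t)"
    using o t by (simp add: fiber_proj_eq_iff lnorm_diff_star)
qed (use t in blast)

section \<open>The fiber category and its projection functor\<close>

lemmas fiber_simps = vecs_fiber_arrs vadd_fiber_arrs vscale_fiber_arrs vnorm_fiber_arrs
  fiber_comp_proj fiber_star_proj

text \<open>Every fiber arrow is a projection, so the algebraic laws are images of those of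
  \<open>C\<close>, and the norm laws are those of \<open>lnorm x\<close>.\<close>

lemma cstar_category_fiber: "cstar_category (fiber_category X C \<phi> x)"
proof (rule cstar_category.intro; unfold fiber_category_def; clarsimp)
  fix \<rho> \<sigma> assume "\<rho> \<in> objs C" "\<sigma> \<in> objs C"
  then show "complex_banach (fiber_arrs X C \<phi> x \<rho> \<sigma>)"
    by (rule banach_fiber_arrs)
qed (auto simp: fiber_simps linear_map_def antilinear_map_def ident_hom comp_ident ident_comp
    comp_assoc comp_add_right comp_scale_right comp_add_left comp_scale_left star_add star_scale
    star_star star_ident star_comp lnorm_star lnorm_comp lnorm_cstar x)

lemma cstar_functor_fiber:
  "cstar_functor C (fiber_category X C \<phi> x)
    \<lparr>fobj = (\<lambda>\<rho>. (\<rho>, x)), farr = fiber_proj X C \<phi> x\<rparr>"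
proof (rule cstar_functor.intro[OF category cstar_category_fiber])
qed (auto simp: fiber_category_def fiber_simps linear_map_def)

end

end

theorem proposition4p4:
  fixes X :: "'x topology" and C :: "('o, 'a) ccat"
    and \<phi> :: "('x \<Rightarrow> complex) \<Rightarrow> ('o, 'a) multiplier"
  assumes "compact_space X" and "Hausdorff_space X" and "CX_category X C \<phi>"
  shows "\<exists>F :: 'x \<Rightarrow> ('o, 'a, 'o \<times> 'x, 'a fiber_arrow) cfunctor.
    (\<forall>x\<in>topspace X.
       cstar_functor C (fiber_category X C \<phi> x) (F x) \<and>
       (\<forall>\<rho>\<in>objs C. fobj (F x) \<rho> = (\<rho>, x)) \<and>
       (\<forall>\<rho>\<in>objs C. \<forall>\<sigma>\<in>objs C. \<forall>t\<in>hom C \<rho> \<sigma>.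
          farr (F x) \<rho> \<sigma> t = fiber_proj X C \<phi> x \<rho> \<sigma> t)) \<and>
    (\<forall>\<rho>\<in>objs C. \<forall>\<sigma>\<in>objs C. \<forall>t\<in>hom C \<rho> \<sigma>.
       upper_semicontinuous_on X
         (\<lambda>x. vnorm (arrs (fiber_category X C \<phi> x) (\<rho>, x) (\<sigma>, x)) (farr (F x) \<rho> \<sigma> t)) \<and>
       ennreal (vnorm (arrs C \<rho> \<sigma>) t) =
         (SUP x\<in>topspace X. ennreal
            (vnorm (arrs (fiber_category X C \<phi> x) (\<rho>, x) (\<sigma>, x)) (farr (F x) \<rho> \<sigma> t))))"
proof -
  interpret compact_CX_category X C \<phi>
    using assms by (intro compact_CX_category.intro compact_CX_category_axioms.intro)
  define F :: "'x \<Rightarrow> ('o, 'a, 'o \<times> 'x, 'a fiber_arrow) cfunctor"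
    where "F x = \<lparr>fobj = (\<lambda>\<rho>. (\<rho>, x)), farr = fiber_proj X C \<phi> x\<rparr>" for x
  have norm: "vnorm (arrs (fiber_category X C \<phi> x) (\<rho>, x) (\<sigma>, x)) (farr (F x) \<rho> \<sigma> t) =
      lnorm x \<rho> \<sigma> t"
    if "x \<in> topspace X" "\<rho> \<in> objs C" "\<sigma> \<in> objs C" "t \<in> hom C \<rho> \<sigma>" for x \<rho> \<sigma> t
    using that by (simp add: F_def fiber_category_def vnorm_fiber_arrs)
  have usc: "upper_semicontinuous_on X
      (\<lambda>x. vnorm (arrs (fiber_category X C \<phi> x) (\<rho>, x) (\<sigma>, x)) (farr (F x) \<rho> \<sigma> t))"
    if "\<rho> \<in> objs C" "\<sigma> \<in> objs C" "t \<in> hom C \<rho> \<sigma>" for \<rho> \<sigma> t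
    using upper_semicontinuous_lnorm[OF that] that
    by (simp add: upper_semicontinuous_on_def norm cong: conj_cong)
  have sup: "ennreal (vnorm (arrs C \<rho> \<sigma>) t) = (SUP x\<in>topspace X. ennreal
      (vnorm (arrs (fiber_category X C \<phi> x) (\<rho>, x) (\<sigma>, x)) (farr (F x) \<rho> \<sigma> t)))"
    if t: "\<rho> \<in> objs C" "\<sigma> \<in> objs C" "t \<in> hom C \<rho> \<sigma>" for \<rho> \<sigma> t
  proof -
    let ?S = "SUP x\<in>topspace X. ennreal (lnorm x \<rho> \<sigma> t)"
    have "?S \<le> ennreal (vnorm (arrs C \<rho> \<sigma>) t)"
      using t by (intro SUP_least ennreal_leI lnorm_le_norm)
    moreover have "ennreal (vnorm (arrs C \<rho> \<sigma>) t) \<le> ?S"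
    \<comment> \<open>The infinite case is trivial for this inequality; in the finite one
      \<open>enn2real\<close> turns the supremum into a real bound.\<close>
    proof (cases "?S = top")
      case False
      show ?thesis
      proof (rule ennreal_le_epsilon)
        fix e :: real assume e: "e > 0"
        \<comment> \<open>\<open>norm_le_of_lnorm_less\<close> asks for a strict bound at every
          point, which the supremum gives only after adding \<open>e\<close>. On an empty space the
          bound holds vacuously and \<open>?S\<close> is 0.\<close>
        have "lnorm x \<rho> \<sigma> t < enn2real ?S + e" if x: "x \<in> topspace X" for x
        proof -
          have "ennreal (lnorm x \<rho> \<sigma> t) \<le> ?S"
            using x by (rule SUP_upper)
          then have "enn2real (ennreal (lnorm x \<rho> \<sigma> t)) \<le> enn2real ?S"
            using False by (intro enn2real_mono) (simp_all only: less_top)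
          then show ?thesis
            using e lnorm_nonneg[OF t(1,2) x t(3)] by (simp del: enn2real_le)
        qed
        then have "vnorm (arrs C \<rho> \<sigma>) t \<le> enn2real ?S + e"
          using t e by (intro norm_le_of_lnorm_less) auto
        then have "ennreal (vnorm (arrs C \<rho> \<sigma>) t) \<le> ennreal (enn2real ?S) + ennreal e"
          using e by (simp add: ennreal_leI flip: ennreal_plus)
        then show "ennreal (vnorm (arrs C \<rho> \<sigma>) t) \<le> ?S + ennreal e"
          using False by (simp only: ennreal_enn2real less_top)
      qed
    qed (simp only: top_greatest)
    ultimately have "ennreal (vnorm (arrs C \<rho> \<sigma>) t) = ?S"
      by (rule antisym[rotated])
    also have "\<dots> = (SUP x\<in>topspace X. ennreal
        (vnorm (arrs (fiber_category X C \<phi> x) (\<rho>, x) (\<sigma>, x)) (farr (F x) \<rho> \<sigma> t)))"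
      using t by (intro SUP_cong) (simp_all add: norm)
    finally show ?thesis .
  qed
  show ?thesis
    using cstar_functor_fiber usc sup by (intro exI[of _ F]) (simp add: F_def)
qed

end
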